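(* Let $\mathscr E$ be a Hilbert $C^*$-module over a $C^*$-algebra such that $\mathcal L(\mathscr E)$ is a $W^*$-algebra. Let $A,B\in\mathcal L(\mathscr E)$ and suppose that $\overline{\mathscr R(A^* )}=\mathscr E$. Then $BB^*\leq\lambda AA^*$ for some $\lambda>0$ if and only if $\mathscr R(B)\subseteq\mathscr R(A)$.
   Context: $\mathcal L(\mathscr E)$ is the $C^*$-algebra of adjointable operators on $\mathscr E$; $\mathscr R(T)$ denotes the range of $T$, and the closure is in the norm of $\mathscr E$. *)

theory Defs
  imports "HOL-Analysis.Analysis"
begin

class scaleC =
  fixes scaleC :: "complex \<Rightarrow> 'a \<Rightarrow> 'a"  (infixr "*\<^sub>C" 75)

class complex_normed_vector = real_normed_vector + scaleC +
  assumes scaleC_add_right: "c *\<^sub>C (x + y) = c *\<^sub>C x + c *\<^sub>C y"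
    and scaleC_add_left: "(c + d) *\<^sub>C x = c *\<^sub>C x + d *\<^sub>C x"
    and scaleC_scaleC: "c *\<^sub>C d *\<^sub>C x = (c * d) *\<^sub>C x"
    and scaleC_of_real: "complex_of_real r *\<^sub>C x = r *\<^sub>R x"
    and norm_scaleC: "norm (c *\<^sub>C x) = cmod c * norm x"

class complex_banach = complex_normed_vector + complete_space

(* No unit is assumed. *)
class cstar_algebra = complex_banach + real_normed_algebra +
  fixes star :: "'a \<Rightarrow> 'a"
  assumes mult_scaleC_left: "(c *\<^sub>C a) * b = c *\<^sub>C (a * b)"
    and mult_scaleC_right: "a * (c *\<^sub>C b) = c *\<^sub>C (a * b)"
    and star_star: "star (star a) = a"
    and star_add: "star (a + b) = star a + star b"
    and star_scaleC: "star (c *\<^sub>C a) = cnj c *\<^sub>C star a"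
    and star_mult: "star (a * b) = star b * star a"
    and cstar_identity: "norm (star a * a) = (norm a)\<^sup>2"

definition cstar_positive :: "'a::cstar_algebra \<Rightarrow> bool" where
  "cstar_positive a \<longleftrightarrow> (\<exists>b. a = star b * b)"

(* Right Hilbert modules, with inner product linear in the second argument.  The norm of
   the type of the module is required to be the one induced by the inner product, so the
   class complex_banach supplies completeness and the norm topology. *)
locale hilbert_cstar_module =
  fixes ip :: "'e::complex_banach \<Rightarrow> 'e \<Rightarrow> 'a::cstar_algebra"
    and act :: "'e \<Rightarrow> 'a \<Rightarrow> 'e"
  assumes act_add_left: "act (x + y) a = act x a + act y a"
    and act_add_right: "act x (a + b) = act x a + act x b"
    and act_mult: "act x (a * b) = act (act x a) b"
    and act_scaleC_left: "act (c *\<^sub>C x) a = c *\<^sub>C act x a"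
    and act_scaleC_right: "act x (c *\<^sub>C a) = c *\<^sub>C act x a"
    and ip_add_right: "ip x (y + z) = ip x y + ip x z"
    and ip_scaleC_right: "ip x (c *\<^sub>C y) = c *\<^sub>C ip x y"
    and ip_act_right: "ip x (act y a) = ip x y * a"
    and ip_star: "star (ip x y) = ip y x"
    and ip_positive: "cstar_positive (ip x x)"
    and ip_definite: "ip x x = 0 \<longleftrightarrow> x = 0"
    and norm_eq_ip: "norm x = sqrt (norm (ip x x))"

(* The C*-algebra L(E): product is composition, involution is module_adjoint, and the norm
   is the operator norm onorm.  Linearity and boundedness follow from adjointability. *)
definition adjointable_ops ::
    "('e::complex_banach \<Rightarrow> 'e \<Rightarrow> 'a::cstar_algebra) \<Rightarrow> ('e \<Rightarrow> 'e) set" where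
  "adjointable_ops ip = {T. \<exists>S. \<forall>x y. ip (T x) y = ip x (S y)}"

definition module_adjoint ::
    "('e::complex_banach \<Rightarrow> 'e \<Rightarrow> 'a::cstar_algebra) \<Rightarrow> ('e \<Rightarrow> 'e) \<Rightarrow> 'e \<Rightarrow> 'e" where
  "module_adjoint ip T = (THE S. \<forall>x y. ip (T x) y = ip x (S y))"

(* Positivity and order in the C*-algebra L(E), in the sense of cstar_positive. *)
definition op_positive ::
    "('e::complex_banach \<Rightarrow> 'e \<Rightarrow> 'a::cstar_algebra) \<Rightarrow> ('e \<Rightarrow> 'e) \<Rightarrow> bool" where
  "op_positive ip T \<longleftrightarrow> (\<exists>S\<in>adjointable_ops ip. T = module_adjoint ip S \<circ> S)"

definition op_le ::
    "('e::complex_banach \<Rightarrow> 'e \<Rightarrow> 'a::cstar_algebra) \<Rightarrow> ('e \<Rightarrow> 'e) \<Rightarrow> ('e \<Rightarrow> 'e) \<Rightarrow> bool" where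
  "op_le ip S T \<longleftrightarrow> op_positive ip (\<lambda>x. T x - S x)"

definition dual_space :: "('p::complex_normed_vector \<Rightarrow> complex) set" where
  "dual_space = {f. bounded_linear f \<and> (\<forall>c x. f (c *\<^sub>C x) = c * f x)}"

(* Sakai's definition: a C*-algebra M is a W*-algebra if, as a Banach space, it is
   isometrically isomorphic to the dual of some Banach space.  M is a C*-algebra of
   operators with the operator norm.  HOL cannot quantify existentially over the type 'p of
   the predual, so it is a parameter; "M is a W*-algebra" as a hypothesis is this predicate
   with 'p a free type variable. *)
definition is_W_star_algebra ::
    "'p::complex_banach itself \<Rightarrow> ('e::complex_banach \<Rightarrow> 'e) set \<Rightarrow> bool" where
  "is_W_star_algebra (P :: 'p itself) M \<longleftrightarrow>
    (\<exists>\<Phi> :: ('e \<Rightarrow> 'e) \<Rightarrow> 'p \<Rightarrow> complex.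
       bij_betw \<Phi> M dual_space \<and>
       (\<forall>S\<in>M. \<forall>T\<in>M. \<Phi> (\<lambda>x. S x + T x) = (\<lambda>p. \<Phi> S p + \<Phi> T p)) \<and>
       (\<forall>c. \<forall>T\<in>M. \<Phi> (\<lambda>x. c *\<^sub>C T x) = (\<lambda>p. c * \<Phi> T p)) \<and>
       (\<forall>T\<in>M. onorm (\<Phi> T) = onorm T))"

end

theory Submission
  imports Defs
begin

text \<open>The theorem is Douglas' range inclusion theorem for adjointable operators.  Each condition is shown
to be equivalent to a factorization \<open>B = A C\<close> with \<open>C\<close> adjointable.

\<^bold>\<open>From range inclusion to majorization.\<close>  Choose \<open>C x\<close> with \<open>A (C x) = B x\<close>.  Then
\<open>\<langle>C x, A\<^sup>* y\<rangle> = \<langle>x, B\<^sup>* y\<rangle>\<close>, so \<open>A\<^sup>* y \<mapsto> B\<^sup>* y\<close> is a candidate for the adjoint of \<open>C\<close> on the dense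
range of \<open>A\<^sup>*\<close>.  It is bounded there by the uniform boundedness principle, because the same equation
bounds the vectors \<open>B\<^sup>* y\<close> with \<open>\<parallel>A\<^sup>* y\<parallel> \<le> 1\<close> weakly.  Hence it extends to all of the module, and \<open>C\<close> is
adjointable (\<open>factor_of_range_subset\<close>).  For large \<open>l\<close> the operator \<open>l - C C\<^sup>*\<close> has a self-adjoint square
root, and \<open>l A A\<^sup>* - B B\<^sup>* = A (l - C C\<^sup>*) A\<^sup>*\<close> is positive.

\<^bold>\<open>From majorization to range inclusion.\<close>  Put \<open>a = A\<^sup>*\<close>, scaled to norm at most 1, and \<open>b = B\<^sup>*\<close>, so
that \<open>b\<^sup>* b \<le> r a\<^sup>* a\<close>.  The iteration \<open>c\<^sub>n\<^sub>+\<^sub>1 = c\<^sub>n + (b - c\<^sub>n a) a\<^sup>*\<close> stays bounded, and \<open>c\<^sub>n a\<close> tends to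
\<open>b\<close> in norm (\<open>approximate_factorization\<close>).  As the algebra is a dual Banach space, \<open>c\<^sub>n\<close> has a weak-*
cluster point \<open>c\<close> (\<open>ball_cluster_point\<close>).  An abstract predual gives no direct access to the
continuity of multiplication; all that is used is that weak-* limits stay in closed balls.  Let
\<open>u = c - c\<^sub>m\<close> and \<open>g = a a\<^sup>*\<close>, and for \<open>n \<ge> m\<close> let \<open>K\<close> bound \<open>\<parallel>c\<^sub>n - c\<^sub>m\<parallel>\<close> and \<open>e\<close> bound
\<open>\<parallel>(c\<^sub>n - c\<^sub>m) a\<parallel>\<close>.  The elements \<open>c\<^sub>n - c\<^sub>m + t u g\<close> then have norm squared at most
\<open>K\<^sup>2 + 2 t e K + t\<^sup>2 \<parallel>u g\<parallel>\<^sup>2\<close>, for \<open>t > 0\<close>.  So does the cluster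
point \<open>u + t u g\<close>, whereas its norm squared is at least \<open>(2 t + t\<^sup>2) \<parallel>u g\<parallel>\<^sup>2\<close>.  Letting \<open>t\<close> grow gives
\<open>\<parallel>u g\<parallel>\<^sup>2 \<le> e K\<close>, whence \<open>(c a - b) a\<^sup>* = 0\<close>, and this forces \<open>c a = b\<close>
(\<open>factorization_of_majorized\<close>).  Taking adjoints gives \<open>B = A C\<close> with \<open>C\<close> a multiple of \<open>c\<^sup>*\<close>.

\<^bold>\<open>The order of a C*-algebra.\<close>  These arguments need that positive elements form a cone on which the
norm is monotone, and that every \<open>b\<^sup>* b\<close> lies in it (\<open>nonneg_st_mult\<close>).  Both are proved without
spectral theory: positivity is expressed by the norm, and square roots of elements near 1 come from
Banach's fixed point theorem.  The results are used twice.  Applied to left multiplications on the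
coefficient algebra they yield the Cauchy-Schwarz inequality of a Hilbert module, which makes the
adjointable operators a C*-algebra; applied to that algebra they yield the theorem.\<close>

section \<open>Unital C*-algebras\<close>

text \<open>The carrier is a set, because the adjointable operators form a subset of all bounded operators that
depends on the inner product.  Multiplication by the complex unit is given by a central element \<open>J\<close>.
The unit may be \<open>0\<close>, which happens for the operators on the zero module.\<close>
locale unital_cstar =
  fixes M :: "'b::{real_normed_algebra,monoid_mult,banach} set"
    and st :: "'b \<Rightarrow> 'b" and J :: 'b
  assumes one_mem [simp]: "1 \<in> M"
    and J_mem [simp]: "J \<in> M"
    and add_mem [simp]: "\<And>x y. x \<in> M \<Longrightarrow> y \<in> M \<Longrightarrow> x + y \<in> M"
    and mult_mem [simp]: "\<And>x y. x \<in> M \<Longrightarrow> y \<in> M \<Longrightarrow> x * y \<in> M"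
    and scaleR_mem [simp]: "\<And>r x. x \<in> M \<Longrightarrow> r *\<^sub>R x \<in> M"
    and st_mem [simp]: "\<And>x. x \<in> M \<Longrightarrow> st x \<in> M"
    and st_st [simp]: "\<And>x. x \<in> M \<Longrightarrow> st (st x) = x"
    and st_add [simp]: "\<And>x y. x \<in> M \<Longrightarrow> y \<in> M \<Longrightarrow> st (x + y) = st x + st y"
    and st_scaleR [simp]: "\<And>r x. x \<in> M \<Longrightarrow> st (r *\<^sub>R x) = r *\<^sub>R st x"
    and st_mult [simp]: "\<And>x y. x \<in> M \<Longrightarrow> y \<in> M \<Longrightarrow> st (x * y) = st y * st x"
    and st_J [simp]: "st J = - J"
    and J_J: "J * J = - 1"
    and J_central: "\<And>x. x \<in> M \<Longrightarrow> J * x = x * J"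
    and norm_st_mult: "\<And>x. x \<in> M \<Longrightarrow> norm (st x * x) = (norm x)\<^sup>2"
    and closed_self_adjoint: "closed {x \<in> M. st x = x}"
begin

lemma zero_mem [simp]: "0 \<in> M"
  using scaleR_mem[OF one_mem, of 0] by simp

lemma uminus_mem [simp]: "x \<in> M \<Longrightarrow> - x \<in> M"
  using scaleR_mem[of x "-1"] by simp

lemma minus_mem [simp]: "x \<in> M \<Longrightarrow> y \<in> M \<Longrightarrow> x - y \<in> M"
  using add_mem[of x "- y"] by simp

lemma power_mem [simp]: "x \<in> M \<Longrightarrow> x ^ n \<in> M"
  by (induction n) auto

lemma st_uminus [simp]: "x \<in> M \<Longrightarrow> st (- x) = - st x"
  using st_scaleR[of x "-1"] by simp

lemma st_minus [simp]: "x \<in> M \<Longrightarrow> y \<in> M \<Longrightarrow> st (x - y) = st x - st y"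
  using st_add[of x "- y"] by simp

lemma st_one [simp]: "st 1 = 1"
  using st_mult[of "st 1" 1] by simp

lemma st_zero [simp]: "st 0 = 0"
  using st_scaleR[OF one_mem, of 0] by simp

lemma st_power [simp]: "x \<in> M \<Longrightarrow> st (x ^ n) = st x ^ n"
  by (induction n) (auto simp: power_commutes)

lemma norm_one_le: "norm (1::'b) \<le> 1"
proof -
  have "norm (1::'b) * norm (1::'b) = norm (1::'b)"
    using norm_st_mult[of 1] by (simp add: power2_eq_square)
  then show ?thesis by (metis mult_cancel_right1 norm_ge_zero order_refl zero_le_one)
qed

lemma norm_scaleR_one_le: "norm (r *\<^sub>R (1::'b)) \<le> \<bar>r\<bar>"
  using norm_one_le by (simp add: mult_left_le)

lemma norm_st [simp]:
  assumes "x \<in> M"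
  shows "norm (st x) = norm x"
proof -
  have le: "norm y \<le> norm (st y)" if "y \<in> M" for y
  proof (cases "norm y = 0")
    case False
    have "norm y * norm y \<le> norm (st y) * norm y"
      using norm_st_mult[OF that] norm_mult_ineq[of "st y" y] by (simp add: power2_eq_square)
    then show ?thesis using False by simp
  qed simp
  from le[OF assms] le[of "st x"] assms show ?thesis by simp
qed

lemma norm_square: "x \<in> M \<Longrightarrow> st x = x \<Longrightarrow> norm (x * x) = (norm x)\<^sup>2"
  using norm_st_mult[of x] by simp

lemma norm_mult_st: "x \<in> M \<Longrightarrow> norm (x * st x) = (norm x)\<^sup>2"
  using norm_st_mult[of "st x"] by simp

text \<open>The equation \<open>(1 - S)\<^sup>2 = 1 - T\<close> says that \<open>S\<close> is a fixed point of \<open>S \<mapsto> (T + S\<^sup>2) / 2\<close>.  On the ball of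
radius \<open>r < 1\<close> with \<open>2 r - r\<^sup>2 = \<parallel>T\<parallel>\<close> this map is a contraction.  It preserves the closed set of the
self-adjoint elements that commute with everything in \<open>M\<close> that commutes with \<open>T\<close>.\<close>
lemma sqrt_one_minus:
  assumes T: "T \<in> M" "st T = T" "norm T < 1"
  obtains S where "S \<in> M" "st S = S" "norm S < 1" "(1 - S) * (1 - S) = 1 - T"
    "\<And>z. z \<in> M \<Longrightarrow> z * T = T * z \<Longrightarrow> z * S = S * z"
proof -
  define r where "r = 1 - sqrt (1 - norm T)"
  have r: "0 \<le> r" "r < 1" "norm T + r * r = 2 * r"
  proof -
    have "(1 - r)\<^sup>2 = 1 - norm T" using T(3) by (simp add: r_def)
    then show "norm T + r * r = 2 * r" by (simp add: power2_eq_square algebra_simps)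
    show "0 \<le> r" "r < 1" using T(3) by (auto simp: r_def)
  qed
  define X where "X = {S \<in> M. st S = S} \<inter> cball 0 r \<inter> (\<Inter>z\<in>{z \<in> M. z * T = T * z}. {S. z * S = S * z})"
  define f where "f S = (1/2) *\<^sub>R (T + S * S)" for S
  have "closed X"
    unfolding X_def
    by (intro closed_Int closed_self_adjoint closed_cball closed_INT ballI closed_Collect_eq continuous_intros)
  then have "complete X" by (simp add: complete_eq_closed)
  moreover have "X \<noteq> {}"
    using r(1) by (auto simp: X_def set_eq_iff intro!: exI[of _ 0])
  moreover have "f ` X \<subseteq> X"
  proof clarify
    fix S assume S: "S \<in> X"
    then have nS: "norm S \<le> r" by (simp add: X_def)
    have "norm (S * S) \<le> r * r"
      using norm_mult_ineq[of S S] mult_mono[OF nS nS] r(1) by fastforce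
    then have "norm (f S) \<le> r"
      using norm_triangle_ineq[of T "S * S"] r(3) by (simp add: f_def)
    moreover have "z * f S = f S * z" if z: "z \<in> M" "z * T = T * z" for z
    proof -
      have zS: "z * S = S * z" using S z by (auto simp: X_def)
      have "z * (S * S) = S * S * z"
        by (metis zS mult.assoc)
      then show ?thesis using z(2) by (simp add: f_def algebra_simps)
    qed
    moreover have "f S \<in> M" "st (f S) = f S"
    proof -
      have "S \<in> M" "st S = S" using S by (auto simp only: X_def)
      then show "f S \<in> M" "st (f S) = f S" using T by (simp_all add: f_def)
    qed
    ultimately show "f S \<in> X"
      unfolding X_def mem_cball_0[symmetric] by blast
  qed
  moreover have "dist (f S) (f S') \<le> r * dist S S'" if "S \<in> X" "S' \<in> X" for S S'
  proof -
    have n: "norm S \<le> r" "norm S' \<le> r" using that by (auto simp: X_def)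
    have "f S - f S' = (1/2) *\<^sub>R (S * (S - S') + (S - S') * S')"
      by (simp add: f_def algebra_simps)
    also have "norm \<dots> \<le> (1/2) * (norm S * norm (S - S') + norm (S - S') * norm S')"
      using norm_triangle_ineq[of "S * (S - S')" "(S - S') * S'"]
        norm_mult_ineq[of S "S - S'"] norm_mult_ineq[of "S - S'" S'] by simp
    also have "\<dots> \<le> (1/2) * (r * norm (S - S') + norm (S - S') * r)"
      using n r(1) by (intro mult_left_mono add_mono mult_mono) auto
    finally show ?thesis by (simp add: dist_norm)
  qed
  ultimately obtain S where S: "S \<in> X" "f S = S"
    using Banach_fix[of X r f] r by blast
  have "T + S * S = S + S"
    using arg_cong[OF S(2), of "\<lambda>x. 2 *\<^sub>R x"] by (simp add: f_def scaleR_2)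
  then have "(1 - S) * (1 - S) = 1 - T"
    by (simp add: algebra_simps)
  with S r show ?thesis by (intro that[of S]) (auto simp: X_def)
qed

section \<open>Positive elements\<close>

text \<open>The norm condition says that the spectrum of the self-adjoint element \<open>a\<close> lies in the interval
\<open>[0, 2 t]\<close>.  In this form sums of positive elements are positive by the triangle inequality.\<close>
definition nonneg :: "'b \<Rightarrow> bool" where
  "nonneg a \<longleftrightarrow> a \<in> M \<and> st a = a \<and> (\<exists>t. norm (t *\<^sub>R 1 - a) \<le> t)"

lemma nonneg_mem [dest]: "nonneg a \<Longrightarrow> a \<in> M"
  and nonneg_st [dest]: "nonneg a \<Longrightarrow> st a = a"
  by (auto simp: nonneg_def)

lemma nonneg_add:
  assumes "nonneg a" "nonneg b"
  shows "nonneg (a + b)"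
proof -
  from assms obtain s t where st: "norm (s *\<^sub>R 1 - a) \<le> s" "norm (t *\<^sub>R 1 - b) \<le> t"
    by (auto simp: nonneg_def)
  have "(s + t) *\<^sub>R 1 - (a + b) = (s *\<^sub>R 1 - a) + (t *\<^sub>R 1 - b)" by (simp add: algebra_simps)
  then have "norm ((s + t) *\<^sub>R 1 - (a + b)) \<le> s + t"
    by (smt (verit) st norm_triangle_ineq)
  with assms show ?thesis by (auto simp: nonneg_def)
qed

lemma nonneg_scaleR:
  assumes "nonneg a" "0 \<le> r"
  shows "nonneg (r *\<^sub>R a)"
proof -
  from assms obtain s where "norm (s *\<^sub>R 1 - a) \<le> s"
    by (auto simp: nonneg_def)
  then have "norm (r *\<^sub>R (s *\<^sub>R 1 - a)) \<le> r * s"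
    using assms(2) by (simp add: mult_left_mono)
  then have "norm ((r * s) *\<^sub>R 1 - r *\<^sub>R a) \<le> r * s"
    by (simp add: algebra_simps)
  with assms show ?thesis by (auto simp: nonneg_def)
qed

lemma nonneg_norm_minus:
  assumes "a \<in> M" "st a = a" "norm a \<le> r"
  shows "nonneg (r *\<^sub>R 1 - a)"
  unfolding nonneg_def using assms by (auto intro!: exI[of _ r])

lemma nonneg_scaleR_one: "0 \<le> r \<Longrightarrow> nonneg (r *\<^sub>R 1)"
  using nonneg_norm_minus[of 0 r] by simp

lemma nonneg_zero [simp]: "nonneg 0"
  using nonneg_scaleR_one[of 0] by simp

text \<open>As \<open>x\<close> and \<open>y\<close> commute, \<open>u = x + i y\<close> satisfies \<open>u\<^sup>* u = x\<^sup>2 + y\<^sup>2\<close>, and \<open>x\<close> is the real part of \<open>u\<close>.\<close>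
lemma norm_le_of_sum_squares:
  assumes x: "x \<in> M" "st x = x" and y: "y \<in> M" "st y = y"
    and comm: "x * y = y * x" and sum: "x * x + y * y = r *\<^sub>R 1" and r: "0 \<le> r"
  shows "(norm x)\<^sup>2 \<le> r"
proof -
  define u where "u = x + J * y"
  have u: "u \<in> M" using x y by (simp add: u_def)
  have su: "st u = x - J * y" using x y by (simp add: u_def J_central)
  have JyJy: "J * y * (J * y) = - (y * y)"
  proof -
    have "J * y * (J * y) = J * (y * J) * y" by (simp only: mult.assoc)
    also have "\<dots> = J * (J * y) * y" by (simp only: J_central[OF y(1)])
    also have "\<dots> = (J * J) * (y * y)" by (simp only: mult.assoc)
    finally show ?thesis by (simp add: J_J)
  qed
  have Jyx: "J * y * x = x * (J * y)" using comm J_central x(1)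
    by (metis mult.assoc)
  have "st u * u = x * x + y * y"
    using JyJy Jyx unfolding su unfolding u_def by (simp add: algebra_simps)
  then have "(norm u)\<^sup>2 \<le> r"
    using norm_st_mult[OF u] sum r norm_scaleR_one_le[of r] by simp
  moreover have "norm x \<le> norm u"
  proof -
    have "x = (1/2) *\<^sub>R (u + st u)" unfolding su unfolding u_def by (simp add: scaleR_2[symmetric])
    then have "norm x \<le> (1/2) * (norm u + norm (st u))"
      by (metis abs_of_nonneg mult_left_mono norm_scaleR norm_triangle_ineq zero_le_divide_1_iff zero_le_numeral)
    then show ?thesis using u by simp
  qed
  ultimately show ?thesis
    by (meson norm_ge_zero order_trans power_mono)
qed

text \<open>The shift by \<open>d > 0\<close> moves \<open>a\<close> away from \<open>0\<close>, so that \<open>a + d = (t + d) (1 - T)\<close> with \<open>\<parallel>T\<parallel> < 1\<close> and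
\<open>sqrt_one_minus\<close> applies, to \<open>T\<close> and then to the solution \<open>S\<close>.  The fourth root is wanted later to
write a product \<open>k m\<^sup>2\<close>, with \<open>k\<close> a square root, as the square of a self-adjoint element.\<close>
lemma nonneg_fourth_root:
  assumes a: "nonneg a" and d: "0 < d"
  obtains j where "j \<in> M" "st j = j" "nonneg (j * j)" "(j * j) * (j * j) = a + d *\<^sub>R 1"
    "\<And>z. z \<in> M \<Longrightarrow> z * a = a * z \<Longrightarrow> z * j = j * z"
proof -
  from a obtain t where t: "norm (t *\<^sub>R 1 - a) \<le> t" "a \<in> M" "st a = a" by (auto simp: nonneg_def)
  then have t0: "0 \<le> t" using norm_ge_zero order_trans by blast
  define T where "T = (1 / (t + d)) *\<^sub>R (t *\<^sub>R 1 - a)"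
  have td: "0 < t + d" using t0 d by simp
  have "norm T < 1" using t d td by (simp add: T_def)
  moreover have "T \<in> M" "st T = T" using t by (auto simp: T_def)
  ultimately obtain S where S: "S \<in> M" "st S = S" "norm S < 1" "(1 - S) * (1 - S) = 1 - T"
    "\<And>z. z \<in> M \<Longrightarrow> z * T = T * z \<Longrightarrow> z * S = S * z"
    using sqrt_one_minus by blast
  obtain R where R: "R \<in> M" "st R = R" "norm R < 1" "(1 - R) * (1 - R) = 1 - S"
    "\<And>z. z \<in> M \<Longrightarrow> z * S = S * z \<Longrightarrow> z * R = R * z"
    using sqrt_one_minus S(1-3) by blast
  have zT: "z * T = T * z" if "z * a = a * z" for z
    using that by (simp add: T_def algebra_simps)
  define s where "s = sqrt (t + d) *\<^sub>R (1 - S)"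
  define j where "j = sqrt (sqrt (t + d)) *\<^sub>R (1 - R)"
  have "nonneg s"
    using nonneg_scaleR[OF nonneg_norm_minus[of S 1], of "sqrt (t + d)"] S(1-3) td by (simp add: s_def)
  moreover have "s * s = a + d *\<^sub>R 1"
  proof -
    have "s * s = (t + d) *\<^sub>R ((1 - S) * (1 - S))"
      using td by (simp add: s_def)
    also have "\<dots> = (t + d) *\<^sub>R 1 - (t *\<^sub>R 1 - a)"
    proof -
      have "(t + d) *\<^sub>R T = t *\<^sub>R 1 - a" using td by (simp add: T_def)
      then show ?thesis by (simp only: S(4) scaleR_diff_right)
    qed
    finally show ?thesis by (simp add: algebra_simps)
  qed
  moreover have "j \<in> M" "st j = j" using R by (auto simp: j_def)
  moreover have "s = j * j"
    using td unfolding s_def j_def R(4)[symmetric] by simp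
  moreover have "z * j = j * z" if "z \<in> M" "z * a = a * z" for z
    using R(5)[OF that(1) S(5)[OF that(1) zT[OF that(2)]]] by (simp add: j_def algebra_simps)
  ultimately show ?thesis using that[of j] by simp
qed

lemma nonneg_sqrt:
  assumes a: "nonneg a" and d: "0 < d"
  obtains s where "nonneg s" "s * s = a + d *\<^sub>R 1"
    "\<And>z. z \<in> M \<Longrightarrow> z * a = a * z \<Longrightarrow> z * s = s * z"
proof (rule nonneg_fourth_root[OF a d])
  fix j assume j: "nonneg (j * j)" "(j * j) * (j * j) = a + d *\<^sub>R 1"
    and comm: "\<And>z. z \<in> M \<Longrightarrow> z * a = a * z \<Longrightarrow> z * j = j * z"
  have "z * (j * j) = (j * j) * z" if "z \<in> M" "z * a = a * z" for z
    using comm[OF that] by (metis mult.assoc)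
  with j show thesis by (rule that)
qed

text \<open>The square roots \<open>x\<close> of \<open>a\<close> and \<open>y\<close> of \<open>r - a\<close> commute and satisfy \<open>x\<^sup>2 + y\<^sup>2 = r\<close>, so
\<open>norm_le_of_sum_squares\<close> bounds \<open>\<parallel>x\<^sup>2\<parallel>\<close> by \<open>r\<close>; here both roots exist up to a small shift.\<close>
lemma norm_le_of_nonneg:
  assumes a: "nonneg a" and b: "nonneg (r *\<^sub>R 1 - a)" and r: "0 \<le> r"
  shows "norm a \<le> r"
proof (rule field_le_epsilon)
  fix e :: real assume "0 < e"
  define d where "d = e / 3"
  have d: "0 < d" using \<open>0 < e\<close> by (simp add: d_def)
  obtain x where x: "nonneg x" "x * x = a + d *\<^sub>R 1"
    "\<And>z. z \<in> M \<Longrightarrow> z * a = a * z \<Longrightarrow> z * x = x * z"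
    by (rule nonneg_sqrt[OF a d]) (rule that)
  obtain y where y: "nonneg y" "y * y = (r *\<^sub>R 1 - a) + d *\<^sub>R 1"
    "\<And>z. z \<in> M \<Longrightarrow> z * (r *\<^sub>R 1 - a) = (r *\<^sub>R 1 - a) * z \<Longrightarrow> z * y = y * z"
    by (rule nonneg_sqrt[OF b d]) (rule that)
  have "a * x = x * a" using x(3)[of a] a by auto
  then have "x * y = y * x"
    using x(1) by (intro y(3)) (auto simp: algebra_simps)
  moreover have "x * x + y * y = (r + 2 * d) *\<^sub>R 1"
    by (simp add: x(2) y(2) algebra_simps scaleR_2[symmetric])
  ultimately have "(norm x)\<^sup>2 \<le> r + 2 * d"
    using x(1) y(1) r d by (intro norm_le_of_sum_squares[of x y]) auto
  then have "norm (a + d *\<^sub>R 1) \<le> r + 2 * d"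
    using norm_square[OF nonneg_mem[OF x(1)] nonneg_st[OF x(1)]] x(2) by simp
  moreover have "norm a \<le> norm (a + d *\<^sub>R 1) + norm (d *\<^sub>R (1::'b))"
    using norm_triangle_ineq4[of "a + d *\<^sub>R 1" "d *\<^sub>R 1"] by simp
  ultimately show "norm a \<le> r + e"
    using norm_scaleR_one_le[of d] d d_def by linarith
qed

lemma norm_mono:
  assumes a: "nonneg a" and ba: "nonneg (b - a)"
  shows "norm a \<le> norm b"
proof (rule norm_le_of_nonneg[OF a])
  have "b \<in> M" "st b = b"
    using nonneg_add[OF a ba] by auto
  then have "nonneg (norm b *\<^sub>R 1 - b)" by (intro nonneg_norm_minus) auto
  from nonneg_add[OF this ba] show "nonneg (norm b *\<^sub>R 1 - a)" by simp
qed simp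

text \<open>Any upper bound for the norm serves as the witness \<open>t\<close> in the definition of \<open>nonneg\<close>.\<close>
lemma norm_diff_le:
  assumes a: "nonneg a" and s: "norm a \<le> s"
  shows "norm (s *\<^sub>R 1 - a) \<le> s"
proof -
  have "0 \<le> s" using s norm_ge_zero order_trans by blast
  moreover have "nonneg (s *\<^sub>R 1 - a)" using a s by (intro nonneg_norm_minus) auto
  ultimately show ?thesis using a by (intro norm_le_of_nonneg) auto
qed

text \<open>A common \<open>t\<close> works for all \<open>a + e\<close> with error \<open>e\<close>, by \<open>norm_diff_le\<close>.\<close>
lemma nonneg_limit:
  assumes a: "a \<in> M" "st a = a" and e: "\<And>e. 0 < e \<Longrightarrow> nonneg (a + e *\<^sub>R 1)"
  shows "nonneg a"
proof -
  define t where "t = norm a + 1"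
  have "norm (t *\<^sub>R 1 - a) \<le> t + e" if "0 < e" for e
  proof -
    have "norm (a + e *\<^sub>R 1) \<le> t + e"
      using norm_triangle_ineq[of a "e *\<^sub>R 1"] norm_scaleR_one_le[of e] that
      unfolding t_def by linarith
    from norm_diff_le[OF e[OF that] this] show ?thesis by (simp add: algebra_simps)
  qed
  then have "norm (t *\<^sub>R 1 - a) \<le> t" by (rule field_le_epsilon)
  with a show ?thesis by (auto simp: nonneg_def)
qed

text \<open>Write \<open>1 - x\<^sup>2 / t\<close> as a square \<open>s\<^sup>2\<close>.  Then \<open>s\<^sup>2 + x\<^sup>2 / t = 1\<close>, so \<open>\<parallel>s\<parallel> \<le> 1\<close> by
\<open>norm_le_of_sum_squares\<close>, that is \<open>\<parallel>t - x\<^sup>2\<parallel> \<le> t\<close>.\<close>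
lemma nonneg_square:
  assumes x: "x \<in> M" "st x = x"
  shows "nonneg (x * x)"
proof -
  define t where "t = (norm x)\<^sup>2 + 1"
  have t: "0 < t" by (simp add: t_def add_nonneg_pos)
  define T where "T = (1 / t) *\<^sub>R (x * x)"
  have "norm T < 1" using norm_square[OF x] t by (simp add: T_def t_def)
  moreover have "T \<in> M" "st T = T" using x by (auto simp: T_def)
  ultimately obtain S where S: "S \<in> M" "st S = S" "(1 - S) * (1 - S) = 1 - T"
    "\<And>z. z \<in> M \<Longrightarrow> z * T = T * z \<Longrightarrow> z * S = S * z"
    using sqrt_one_minus by blast
  have "x * S = S * x" using x by (intro S(4)) (auto simp: T_def mult.assoc)
  then have "(norm (1 - S))\<^sup>2 \<le> 1"
    using x S t by (intro norm_le_of_sum_squares[of "1 - S" "(1 / sqrt t) *\<^sub>R x"])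
      (auto simp: algebra_simps T_def)
  then have "norm (1 - T) \<le> 1"
    using norm_square[of "1 - S"] S by auto
  then have "norm (t *\<^sub>R (1 - T)) \<le> t" using t by simp
  moreover have "t *\<^sub>R (1 - T) = t *\<^sub>R 1 - x * x" using t by (simp add: T_def algebra_simps)
  ultimately show ?thesis using x by (auto simp: nonneg_def)
qed

section \<open>Positivity of star products\<close>

text \<open>The sum is twice the sum of the squares of the real and the imaginary part of \<open>b\<close>.\<close>
lemma sum_star_products_nonneg:
  assumes b: "b \<in> M"
  shows "nonneg (st b * b + b * st b)"
proof -
  define x where "x = b + st b"
  define y where "y = J * (b - st b)"
  have x: "x \<in> M" "st x = x" using b by (simp_all add: x_def add.commute)
  have Jd: "J * (b - st b) = (b - st b) * J" using b by (intro J_central) simp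
  have y: "y \<in> M" "st y = y"
  proof -
    show "y \<in> M" using b by (simp add: y_def)
    have "st y = (st b - b) * (- J)" using b by (simp add: y_def)
    also have "\<dots> = (b - st b) * J" by (simp add: algebra_simps)
    finally show "st y = y" by (simp add: y_def Jd)
  qed
  have "y * y = (b - st b) * (J * J) * (b - st b)"
    unfolding y_def by (metis Jd mult.assoc)
  then have yy: "y * y = - ((b - st b) * (b - st b))" by (simp add: J_J algebra_simps)
  have "x * x + y * y = 2 *\<^sub>R (st b * b + b * st b)"
    unfolding yy x_def by (simp add: algebra_simps scaleR_2)
  moreover have "nonneg ((1/2) *\<^sub>R (x * x + y * y))"
    using x y by (intro nonneg_scaleR nonneg_add nonneg_square) auto
  ultimately show ?thesis by simp
qed

text \<open>A quantitative form of the fact that \<open>b\<^sup>* b \<le> 0\<close> implies \<open>b = 0\<close>.  Let \<open>q = b\<^sup>* b\<close>, \<open>p = b b\<^sup>*\<close> and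
\<open>N = \<parallel>b\<parallel>\<^sup>2\<close>.  Since \<open>p + q \<ge> 0\<close> and \<open>q \<le> \<eta>\<close>, the element \<open>p\<close> is at least \<open>-\<eta>\<close>, hence
\<open>\<parallel>N - p\<parallel> \<le> N + \<eta>\<close>.  Therefore \<open>q (N - q) = b\<^sup>* (N - p) b\<close> has norm at most \<open>N (N + \<eta>)\<close>.  If \<open>\<eta>\<close> were
small against \<open>N\<close>, then \<open>q\<close> would come near \<open>-N\<close>, and \<open>q (N - q)\<close> would have norm about \<open>2 N\<^sup>2\<close>.\<close>
lemma norm_square_le_of_almost_nonpos:
  assumes b: "b \<in> M" and eta: "0 \<le> \<eta>" and np: "nonneg (\<eta> *\<^sub>R 1 - st b * b)"
  shows "(norm b)\<^sup>2 \<le> 7 * \<eta>"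
proof (rule ccontr)
  assume neg: "\<not> ?thesis"
  define N where "N = (norm b)\<^sup>2"
  define p where "p = b * st b"
  define q where "q = st b * b"
  have N: "7 * \<eta> < N" "0 < N" using neg eta by (auto simp: N_def)
  have pM: "p \<in> M" "st p = p" and qM: "q \<in> M" "st q = q"
    using b by (auto simp: p_def q_def)
  have nq: "norm q = N" and np': "norm p = N"
    using norm_st_mult[OF b] norm_mult_st[OF b] by (simp_all add: N_def p_def q_def)
  have "nonneg (p + \<eta> *\<^sub>R 1)"
    using nonneg_add[OF sum_star_products_nonneg[OF b] np] by (simp add: p_def algebra_simps)
  moreover have "norm (p + \<eta> *\<^sub>R 1) \<le> N + \<eta>"
    using norm_triangle_ineq[of p "\<eta> *\<^sub>R 1"] norm_scaleR_one_le[of \<eta>] np' eta by linarith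
  ultimately have "norm ((N + \<eta>) *\<^sub>R 1 - (p + \<eta> *\<^sub>R 1)) \<le> N + \<eta>"
    by (rule norm_diff_le)
  then have Np: "norm (N *\<^sub>R 1 - p) \<le> N + \<eta>" by (simp add: algebra_simps)
  have "norm (st b * (N *\<^sub>R 1 - p) * b) \<le> norm b * (N + \<eta>) * norm b"
  proof -
    have "norm (st b * (N *\<^sub>R 1 - p) * b) \<le> norm (st b) * norm (N *\<^sub>R 1 - p) * norm b"
      by (meson mult_right_mono norm_ge_zero norm_mult_ineq order_trans)
    also have "\<dots> \<le> norm b * (N + \<eta>) * norm b"
      using Np b N eta by (intro mult_mono) auto
    finally show ?thesis .
  qed
  moreover have "st b * (N *\<^sub>R 1 - p) * b = N *\<^sub>R q - q * q"
    by (simp add: p_def q_def algebra_simps)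
  ultimately have le: "norm (N *\<^sub>R q - q * q) \<le> N * (N + \<eta>)"
    using N_def by (simp only: power2_eq_square mult_ac)
  \<comment> \<open>Completing the square turns the bound on \<open>q (N - q)\<close> into one on \<open>\<parallel>z\<parallel>\<close>.\<close>
  define z where "z = (N/2) *\<^sub>R 1 - q"
  have z: "z \<in> M" "st z = z" using qM by (auto simp: z_def)
  have "z * z = (N\<^sup>2 / 4) *\<^sub>R 1 - (N *\<^sub>R q - q * q)"
  proof -
    have "z * z = (N/2) *\<^sub>R ((N/2) *\<^sub>R 1) - ((N/2) *\<^sub>R q + (N/2) *\<^sub>R q) + q * q"
      by (simp add: z_def algebra_simps)
    then show ?thesis unfolding scaleR_add_left[symmetric]
      by (simp add: power2_eq_square)
  qed
  then have "norm (z * z) \<le> N\<^sup>2 / 4 + N * (N + \<eta>)"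
    using norm_triangle_ineq4[of "(N\<^sup>2 / 4) *\<^sub>R 1" "N *\<^sub>R q - q * q"]
      norm_scaleR_one_le[of "N\<^sup>2 / 4"] le by simp
  then have zz: "(norm z)\<^sup>2 \<le> N\<^sup>2 / 4 + N * (N + \<eta>)" using norm_square[OF z] by simp
  have "N - \<eta> \<le> norm (\<eta> *\<^sub>R 1 - q)"
    using norm_triangle_ineq4[of "\<eta> *\<^sub>R 1" "\<eta> *\<^sub>R 1 - q"] norm_scaleR_one_le[of \<eta>] nq eta by simp
  also have "norm (\<eta> *\<^sub>R 1 - q) \<le> norm z + \<eta> - N / 2"
  proof (rule norm_le_of_nonneg)
    show "nonneg (\<eta> *\<^sub>R 1 - q)" using np by (simp add: q_def)
    have "nonneg (norm z *\<^sub>R 1 - z)" using z by (intro nonneg_norm_minus) auto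
    then show "nonneg ((norm z + \<eta> - N / 2) *\<^sub>R 1 - (\<eta> *\<^sub>R 1 - q))"
      by (simp add: z_def algebra_simps)
    have "norm q \<le> norm z + norm ((N/2) *\<^sub>R (1::'b))"
      using norm_triangle_ineq4[of "(N/2) *\<^sub>R 1" z] by (simp add: z_def)
    then show "0 \<le> norm z + \<eta> - N / 2"
      using norm_scaleR_one_le[of "N / 2"] nq eta N by linarith
  qed
  finally have "3 * N / 2 - 2 * \<eta> \<le> norm z" by simp
  moreover have "0 \<le> 3 * N / 2 - 2 * \<eta>" using N eta by simp
  ultimately have "(3 * N / 2 - 2 * \<eta>)\<^sup>2 \<le> (norm z)\<^sup>2" by (rule power_mono)
  with zz have "N * N \<le> 7 * \<eta> * N - 4 * (\<eta> * \<eta>)"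
    by (simp add: power2_eq_square field_simps)
  also have "\<dots> \<le> 7 * \<eta> * N" by simp
  finally show False using N by simp
qed

text \<open>The theorem of Fukamiya and Kaplansky.  For \<open>q = b\<^sup>* b\<close> take \<open>k = (q\<^sup>2 + d\<^sup>2)\<^sup>1\<^sup>/\<^sup>2\<close>, an approximation of
the absolute value of \<open>q\<close>, so that \<open>m = k - q\<close> approximates twice the negative part and
\<open>(k + q) m = d\<^sup>2\<close>.  Then \<open>(b m)\<^sup>* (b m) = m q m = d\<^sup>2 m - k m\<^sup>2\<close> is almost negative, so \<open>b m\<close> is small
by the previous lemma.  Consequently \<open>q m\<close>, \<open>m\<^sup>2 = d\<^sup>2 - 2 q m\<close> and \<open>m\<close> are small, and \<open>q\<close> is a limit of
the positive elements \<open>k\<close>.\<close>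
theorem nonneg_st_mult:
  assumes b: "b \<in> M"
  shows "nonneg (st b * b)"
proof (rule nonneg_limit)
  define q where "q = st b * b"
  define C where "C = 2 * norm q + 2"
  have qM: "q \<in> M" "st q = q" using b by (auto simp: q_def)
  show "st b * b \<in> M" "st (st b * b) = st b * b" using b by auto
  fix e :: real assume e: "0 < e"
  define D where "D = 1 + norm b * sqrt (7 * C)"
  have C: "2 \<le> C" by (simp add: C_def)
  have D: "1 \<le> D" using C by (simp add: D_def)
  \<comment> \<open>\<open>C\<close> bounds \<open>\<parallel>m\<parallel>\<close>, and \<open>2 d D\<close> will bound \<open>\<parallel>m\<^sup>2\<parallel>\<close>.\<close>
  define d where "d = min 1 (e\<^sup>2 / (2 * D))"
  have d: "0 < d" "d \<le> 1" "2 * (d * D) \<le> e\<^sup>2"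
    using e D by (auto simp: d_def min_def field_simps)
  have d2: "0 < d\<^sup>2" "d\<^sup>2 \<le> d" using d by (auto simp: power2_eq_square mult_le_cancel_left1)
  obtain j where j: "j \<in> M" "st j = j" "nonneg (j * j)" "(j * j) * (j * j) = q * q + d\<^sup>2 *\<^sub>R 1"
    and comm: "\<And>z. z \<in> M \<Longrightarrow> z * (q * q) = (q * q) * z \<Longrightarrow> z * j = j * z"
    by (rule nonneg_fourth_root[OF nonneg_square[OF qM] d2(1)]) (rule that)
  define k where "k = j * j"
  define m where "m = k - q"
  have kM: "k \<in> M" "st k = k" using j by (auto simp: k_def)
  have mM: "m \<in> M" "st m = m" using kM qM by (auto simp: m_def)
  have jq: "q * j = j * q" using qM by (intro comm) (simp_all add: mult.assoc)
  have kq: "q * k = k * q" unfolding k_def by (metis jq mult.assoc)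
  have km: "k * m = m * k" using kq by (simp add: m_def algebra_simps)
  have jm: "j * m = m * j" using jq by (simp add: m_def k_def algebra_simps)
  have sum: "k * m + q * m = d\<^sup>2 *\<^sub>R 1"
    using kq j(4) by (simp add: m_def k_def[symmetric] algebra_simps)
  have "(norm k)\<^sup>2 \<le> (norm q)\<^sup>2 + 1"
  proof -
    have "norm (k * k) \<le> norm (q * q) + norm (d\<^sup>2 *\<^sub>R (1::'b))"
      unfolding k_def j(4) by (rule norm_triangle_ineq)
    then show ?thesis
      using norm_square[OF kM] norm_square[OF qM] norm_scaleR_one_le[of "d\<^sup>2"] d d2
      by linarith
  qed
  also have "\<dots> \<le> (norm q + 1)\<^sup>2" by (simp add: power2_sum)
  finally have "norm k \<le> norm q + 1" by (rule power2_le_imp_le) simp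
  then have mC: "norm m \<le> C"
    using norm_triangle_ineq4[of k q] by (simp add: m_def C_def)
  have "(norm (b * m))\<^sup>2 \<le> 7 * (d\<^sup>2 * C)"
  proof (rule norm_square_le_of_almost_nonpos)
    show "b * m \<in> M" using b mM by simp
    show "0 \<le> d\<^sup>2 * C" using C by simp
    have "st (b * m) * (b * m) = m * (q * m)"
      using b mM by (simp add: q_def mult.assoc)
    also have "q * m = d\<^sup>2 *\<^sub>R 1 - k * m" using sum by (simp add: algebra_simps)
    also have "m * (d\<^sup>2 *\<^sub>R 1 - k * m) = d\<^sup>2 *\<^sub>R m - m * (k * m)" by (simp add: algebra_simps)
    also have "m * (k * m) = (j * m) * (j * m)"
      unfolding k_def by (metis jm mult.assoc)
    finally have eq: "(d\<^sup>2 * C) *\<^sub>R 1 - st (b * m) * (b * m) = d\<^sup>2 *\<^sub>R (C *\<^sub>R 1 - m) + (j * m) * (j * m)"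
      by (simp add: algebra_simps)
    have "nonneg (d\<^sup>2 *\<^sub>R (C *\<^sub>R 1 - m))"
      using mM mC by (intro nonneg_scaleR nonneg_norm_minus) auto
    moreover have "nonneg ((j * m) * (j * m))"
      using j mM jm by (intro nonneg_square) auto
    ultimately show "nonneg ((d\<^sup>2 * C) *\<^sub>R 1 - st (b * m) * (b * m))"
      unfolding eq by (rule nonneg_add)
  qed
  also have "7 * (d\<^sup>2 * C) = (d * sqrt (7 * C))\<^sup>2" using C by (simp add: power_mult_distrib)
  finally have bm: "norm (b * m) \<le> d * sqrt (7 * C)"
    by (rule power2_le_imp_le) (use d C in simp)
  have "norm (q * m) \<le> norm b * (d * sqrt (7 * C))"
  proof -
    have "norm (q * m) \<le> norm (st b) * norm (b * m)"
      unfolding q_def mult.assoc by (rule norm_mult_ineq)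
    also have "\<dots> \<le> norm b * (d * sqrt (7 * C))"
      using b bm by (simp add: mult_left_mono)
    finally show ?thesis .
  qed
  have "norm (m * m) \<le> e\<^sup>2"
  proof -
    have "m * m = d\<^sup>2 *\<^sub>R 1 - (q * m + q * m)"
      using sum kq by (simp add: m_def algebra_simps)
    then have "norm (m * m) \<le> norm (d\<^sup>2 *\<^sub>R (1::'b)) + norm (q * m + q * m)"
      using norm_triangle_ineq4 by metis
    also have "\<dots> \<le> d\<^sup>2 + 2 * norm (q * m)"
      using norm_scaleR_one_le[of "d\<^sup>2"] norm_triangle_ineq[of "q * m" "q * m"] by simp
    also have "\<dots> \<le> d + 2 * (norm b * (d * sqrt (7 * C)))"
      using \<open>norm (q * m) \<le> _\<close> d2 by simp
    also have "\<dots> \<le> 2 * (d * D)" using d by (simp add: D_def algebra_simps)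
    finally show ?thesis using d by simp
  qed
  then have "(norm m)\<^sup>2 \<le> e\<^sup>2" unfolding norm_square[OF mM] .
  then have "norm m \<le> e" by (rule power2_le_imp_le) (use e in simp)
  then have "nonneg (e *\<^sub>R 1 - m)" using mM by (intro nonneg_norm_minus) auto
  moreover have "nonneg k" using j(3) by (simp add: k_def)
  ultimately have "nonneg (k + (e *\<^sub>R 1 - m))" by (rule nonneg_add[rotated])
  then show "nonneg (st b * b + e *\<^sub>R 1)"
    by (simp add: m_def q_def algebra_simps)
qed

lemma nonneg_mult_st: "b \<in> M \<Longrightarrow> nonneg (b * st b)"
  using nonneg_st_mult[of "st b"] by simp

text \<open>If \<open>a = s\<^sup>2\<close> with \<open>s\<close> self-adjoint, then \<open>x\<^sup>* a x = (s x)\<^sup>* (s x)\<close>; an approximate root suffices because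
the cone is closed.\<close>
lemma nonneg_conj:
  assumes a: "nonneg a" and x: "x \<in> M"
  shows "nonneg (st x * a * x)"
proof (rule nonneg_limit)
  show "st x * a * x \<in> M" using a x by auto
  show "st (st x * a * x) = st x * a * x" using nonneg_mem[OF a] nonneg_st[OF a] x by (simp add: mult.assoc)
  fix e :: real assume e: "0 < e"
  define d where "d = e / ((norm x)\<^sup>2 + 1)"
  have d: "0 < d" "d * (norm x)\<^sup>2 \<le> e"
    using e by (auto simp: d_def field_simps add_pos_nonneg)
  obtain s where s: "nonneg s" "s * s = a + d *\<^sub>R 1"
    by (rule nonneg_sqrt[OF a d(1)])
  have "nonneg (st (s * x) * (s * x))" using s x by (intro nonneg_st_mult) auto
  moreover have "st (s * x) * (s * x) = st x * (s * s) * x"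
    using nonneg_mem[OF s(1)] nonneg_st[OF s(1)] x by (simp add: mult.assoc)
  moreover have "nonneg (e *\<^sub>R 1 - d *\<^sub>R (st x * x))"
    using x d norm_st_mult[OF x] by (intro nonneg_norm_minus) auto
  ultimately have "nonneg (st x * (s * s) * x + (e *\<^sub>R 1 - d *\<^sub>R (st x * x)))"
    using nonneg_add by metis
  then show "nonneg (st x * a * x + e *\<^sub>R 1)"
    by (simp add: s(2) algebra_simps)
qed

lemma norm_le_of_st_mult_le:
  assumes "x \<in> M" "y \<in> M" "nonneg (r *\<^sub>R (st y * y) - st x * x)" "0 \<le> r"
  shows "(norm x)\<^sup>2 \<le> r * (norm y)\<^sup>2"
  using norm_mono[OF nonneg_st_mult[OF assms(1)] assms(3)] norm_st_mult[OF assms(1)]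
    norm_st_mult[OF assms(2)] assms(4) by simp

lemma nonneg_conj_st:
  assumes a: "nonneg a" and x: "x \<in> M"
  shows "nonneg (x * a * st x)"
  using nonneg_conj[OF a, of "st x"] x by simp

section \<open>Factorization of majorized elements\<close>

text \<open>With \<open>T = a\<^sup>* a\<close> and \<open>Q = 1 - T\<close>, the elements \<open>d k = Q\<^sup>k T Q\<^sup>k\<close> decrease in \<open>k\<close>.  Moreover
\<open>1 - Q\<^sup>2 = 2 T - T\<^sup>2 \<ge> T\<close> gives \<open>d k \<le> Q\<^sup>2\<^sup>k - Q\<^sup>2\<^sup>k\<^sup>+\<^sup>2\<close>, which telescopes.  Hence
\<open>n d n \<le> \<Sum>k<n. d k \<le> 1 - Q\<^sup>2\<^sup>n\<close>; the induction carries this inequality.\<close>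
lemma powers_of_complement_decay:
  assumes a: "a \<in> M" "norm a \<le> 1"
  shows "real n * (norm (a * (1 - st a * a) ^ n))\<^sup>2 \<le> 1"
proof -
  define Q where "Q = 1 - st a * a"
  have Q: "Q \<in> M" "st Q = Q" using a by (auto simp: Q_def)
  have Qn: "Q ^ k \<in> M" "st (Q ^ k) = Q ^ k" for k using Q by auto
  define T where "T = st a * a"
  have T1: "T = 1 - Q" by (simp add: Q_def T_def)
  have na: "norm (a * st a) \<le> 1" using norm_mult_st[OF a(1)] a(2) by (simp add: power_le_one)
  have TT: "nonneg (T - T * T)"
  proof -
    have "nonneg (1 *\<^sub>R 1 - a * st a)" using a na by (intro nonneg_norm_minus) auto
    from nonneg_conj[OF this a(1)] show ?thesis by (simp add: T_def algebra_simps)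
  qed
  have QQT: "nonneg (T - Q * T * Q)"
  proof -
    have TM: "T \<in> M" "st T = T" "norm T \<le> 1"
      using a norm_st_mult[OF a(1)] by (simp_all add: T_def power_le_one)
    have "nonneg (1 *\<^sub>R 1 - T)" using TM by (intro nonneg_norm_minus)
    from nonneg_add[OF nonneg_square[OF TM(1,2)] nonneg_conj[OF this TM(1)]]
    have "nonneg (T * T + T * (1 - T) * T)" by (simp add: TM)
    moreover have "T * T + T * (1 - T) * T = T - Q * T * Q"
      by (simp add: T1 algebra_simps)
    ultimately show ?thesis by simp
  qed
  define d where "d k = Q ^ k * T * Q ^ k" for k
  have d_mem: "nonneg (d k)" for k
    unfolding d_def T_def using nonneg_conj[OF nonneg_st_mult[OF a(1)] Qn(1)[of k]] Qn(2)[of k] by simp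
  have "nonneg (1 *\<^sub>R 1 - (real n *\<^sub>R d n + Q ^ n * Q ^ n))" for n
  proof (induction n)
    case 0
    then show ?case by simp
  next
    case (Suc n)
    have "nonneg (Q ^ n * (T - Q * T * Q) * Q ^ n)"
      using nonneg_conj[OF QQT Qn(1)[of n]] Qn(2)[of n] by simp
    moreover have "d (Suc n) = Q ^ n * (Q * T * Q) * Q ^ n"
      unfolding d_def by (subst power_Suc2) (simp add: mult.assoc)
    ultimately have dec: "nonneg (d n - d (Suc n))"
      by (simp add: d_def left_diff_distrib right_diff_distrib)
    have "nonneg (Q ^ n * (T - T * T) * Q ^ n)"
      using nonneg_conj[OF TT Qn(1)[of n]] Qn(2)[of n] by simp
    also have "T - T * T = 1 - Q * Q - T" by (simp add: T1 algebra_simps)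
    also have "Q ^ n * (1 - Q * Q - T) * Q ^ n = Q ^ n * Q ^ n - Q ^ n * (Q * Q) * Q ^ n - d n"
      by (simp add: d_def left_diff_distrib right_diff_distrib)
    also have "Q ^ n * (Q * Q) * Q ^ n = Q ^ Suc n * Q ^ Suc n"
      by (subst power_Suc2) (simp add: mult.assoc)
    finally have tel: "nonneg (Q ^ n * Q ^ n - Q ^ Suc n * Q ^ Suc n - d n)" .
    have "nonneg ((1 *\<^sub>R 1 - (real n *\<^sub>R d n + Q ^ n * Q ^ n))
        + (Q ^ n * Q ^ n - Q ^ Suc n * Q ^ Suc n - d n)
        + real (Suc n) *\<^sub>R (d n - d (Suc n)))"
      using Suc tel dec by (intro nonneg_add nonneg_scaleR) auto
    then show ?case by (simp add: algebra_simps del: power_Suc)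
  qed
  from nonneg_add[OF this[of n] nonneg_square[OF Qn[of n]]]
  have "nonneg (1 *\<^sub>R 1 - real n *\<^sub>R d n)" by simp
  then have "norm (real n *\<^sub>R d n) \<le> 1"
    using d_mem by (intro norm_le_of_nonneg nonneg_scaleR) auto
  moreover have "st (a * Q ^ n) * (a * Q ^ n) = d n"
    using a Qn[of n] by (simp add: d_def T_def mult.assoc)
  ultimately show ?thesis
    using norm_st_mult[of "a * Q ^ n"] a Qn[of n] by (simp add: Q_def)
qed

text \<open>The Landweber iteration \<open>c\<^sub>n\<^sub>+\<^sub>1 = c\<^sub>n + (b - c\<^sub>n a) a\<^sup>*\<close> with \<open>c\<^sub>0 = 0\<close>, in the closed form \<open>c\<^sub>n = b S n\<close>.
Majorization gives \<open>\<parallel>b z\<parallel> \<le> sqrt r \<parallel>a z\<parallel>\<close> for all \<open>z\<close>.  This bounds \<open>c\<^sub>n\<close> through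
\<open>a S n = 1 - P\<^sup>n\<close> and the residual \<open>b - c\<^sub>n a = b Q\<^sup>n\<close> through \<open>powers_of_complement_decay\<close>.\<close>
lemma approximate_factorization:
  assumes a: "a \<in> M" "norm a \<le> 1" and b: "b \<in> M" and r: "0 \<le> r"
    and ba: "nonneg (r *\<^sub>R (st a * a) - st b * b)"
  obtains c :: "nat \<Rightarrow> 'b"
  where "\<And>n. c n \<in> M" "\<And>n. norm (c n) \<le> 2 * sqrt r" "(\<lambda>n. c n * a) \<longlonglongrightarrow> b"
proof -
  define Q where "Q = 1 - st a * a"
  define P where "P = 1 - a * st a"
  have QM: "Q \<in> M" and PM: "P \<in> M" using a by (auto simp: Q_def P_def)
  have bz: "norm (b * z) \<le> sqrt r * norm (a * z)" if z: "z \<in> M" for z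
  proof -
    have "nonneg (r *\<^sub>R (st (a * z) * (a * z)) - st (b * z) * (b * z))"
      using nonneg_conj[OF ba z] a(1) b z by (simp add: algebra_simps)
    then have "(norm (b * z))\<^sup>2 \<le> r * (norm (a * z))\<^sup>2"
      using a b z r by (intro norm_le_of_st_mult_le) auto
    also have "\<dots> = (sqrt r * norm (a * z))\<^sup>2" using r by (simp add: power_mult_distrib)
    finally show ?thesis by (rule power2_le_imp_le) (use r in simp)
  qed
  define S where "S n = (\<Sum>k<n. Q ^ k) * st a" for n
  have SM: "S n \<in> M" for n
  proof -
    have "(\<Sum>k<n. Q ^ k) \<in> M" by (induction n) (use QM in auto)
    then show ?thesis using a by (simp add: S_def)
  qed
  have S_Suc: "S (Suc n) = S n + Q ^ n * st a" for n by (simp add: S_def algebra_simps)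
  have Sa: "S n * a = 1 - Q ^ n" for n
  proof (induction n)
    case (Suc n)
    have "S (Suc n) * a = S n * a + Q ^ n * (1 - Q)" by (simp add: S_Suc Q_def algebra_simps)
    then show ?case unfolding Suc.IH by (simp add: algebra_simps power_commutes)
  qed (simp add: S_def)
  have aQ: "a * Q ^ n = P ^ n * a" for n
  proof (induction n)
    case (Suc n)
    have "a * Q ^ Suc n = a * Q ^ n * Q" by (simp add: power_commutes mult.assoc)
    also have "\<dots> = P ^ n * (a * Q)" by (simp add: Suc.IH mult.assoc)
    also have "a * Q = P * a" by (simp add: P_def Q_def algebra_simps)
    also have "P ^ n * (P * a) = P ^ Suc n * a" by (simp add: power_commutes mult.assoc[symmetric])
    finally show ?case .
  qed simp
  have aS: "a * S n = 1 - P ^ n" for n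
  proof (induction n)
    case (Suc n)
    have "a * S (Suc n) = a * S n + (a * Q ^ n) * st a" by (simp add: S_Suc algebra_simps)
    also have "\<dots> = 1 - P ^ n + P ^ n * (1 - P)" by (simp add: Suc.IH aQ P_def mult.assoc)
    finally show ?case by (simp add: algebra_simps power_commutes)
  qed (simp add: S_def)
  have "norm P \<le> 1"
    using norm_diff_le[OF nonneg_mult_st[OF a(1)], of 1] norm_mult_st[OF a(1)] a(2)
    by (simp add: P_def power_le_one)
  then have Pn: "norm (P ^ n) \<le> 1" for n
  proof (induction n)
    case (Suc n)
    then show ?case using norm_mult_ineq[of P "P ^ n"] mult_le_one[of "norm P" "norm (P ^ n)"] by simp
  qed (simp add: norm_one_le)
  show thesis
  proof (rule that[of "\<lambda>n. b * S n"])
    show "b * S n \<in> M" for n using b SM by simp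
    show "norm (b * S n) \<le> 2 * sqrt r" for n
    proof -
      have "norm (b * S n) \<le> sqrt r * norm (1 - P ^ n)" using bz[OF SM, of n] by (simp add: aS)
      also have "norm (1 - P ^ n) \<le> 2"
        using norm_triangle_ineq4[of 1 "P ^ n"] norm_one_le Pn[of n] by linarith
      finally show ?thesis using r by (simp add: mult_left_mono)
    qed
    have "(\<lambda>n. b - b * S n * a) \<longlonglongrightarrow> 0"
    proof (rule Lim_null_comparison)
      have "norm (b - b * S n * a) \<le> sqrt r * (1 / sqrt (real n))" if "0 < n" for n
      proof -
        have "b - b * S n * a = b * Q ^ n" by (simp add: mult.assoc Sa algebra_simps)
        then have "norm (b - b * S n * a) \<le> sqrt r * norm (a * Q ^ n)"
          using bz[of "Q ^ n"] QM by simp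
        also have "norm (a * Q ^ n) \<le> 1 / sqrt (real n)"
        proof (rule power2_le_imp_le)
          show "(norm (a * Q ^ n))\<^sup>2 \<le> (1 / sqrt (real n))\<^sup>2"
            using powers_of_complement_decay[OF a, of n] that by (simp add: Q_def power_divide field_simps)
        qed simp
        finally show ?thesis using r by (simp add: mult_left_mono)
      qed
      then show "\<forall>\<^sub>F n in sequentially. norm (b - b * S n * a) \<le> sqrt r * (1 / sqrt (real n))"
        by (auto intro!: eventually_sequentiallyI[of 1])
      have "(\<lambda>n. 1 / sqrt (real n)) \<longlonglongrightarrow> 0"
        by (intro tendsto_divide_0[OF tendsto_const] filterlim_at_top_imp_at_infinity
            filterlim_compose[OF sqrt_at_top filterlim_real_sequentially])
      from tendsto_mult_left[OF this, of "sqrt r"]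
      show "(\<lambda>n. sqrt r * (1 / sqrt (real n))) \<longlonglongrightarrow> 0" by simp
    qed
    from tendsto_diff[OF tendsto_const[of b] this] show "(\<lambda>n. b * S n * a) \<longlonglongrightarrow> b" by simp
  qed
qed

text \<open>The hypothesis \<open>cluster\<close> is the trace of weak-* compactness that the proof needs: a bounded sequence
has a cluster point \<open>c'\<close> lying in every closed ball that contains a tail of the sequence.\<close>
theorem factorization_of_majorized:
  assumes a: "a \<in> M" "norm a \<le> 1" and b: "b \<in> M" and r: "0 \<le> r"
    and ba: "nonneg (r *\<^sub>R (st a * a) - st b * b)"
    and cluster: "\<And>(c :: nat \<Rightarrow> 'b) K. (\<And>n. c n \<in> M) \<Longrightarrow> (\<And>n. norm (c n) \<le> K) \<Longrightarrow>
      \<exists>c'\<in>M. \<forall>z\<in>M. \<forall>L. \<forall>m. (\<forall>n\<ge>m. norm (c n + z) \<le> L) \<longrightarrow> norm (c' + z) \<le> L"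
  shows "\<exists>c\<in>M. c * a = b"
proof -
  obtain c :: "nat \<Rightarrow> 'b" where c: "\<And>n. c n \<in> M" "\<And>n. norm (c n) \<le> 2 * sqrt r" "(\<lambda>n. c n * a) \<longlonglongrightarrow> b"
    by (rule approximate_factorization[OF a b r ba]) (rule that)
  obtain c' where c': "c' \<in> M"
    "\<And>z L m. z \<in> M \<Longrightarrow> (\<And>n. n \<ge> m \<Longrightarrow> norm (c n + z) \<le> L) \<Longrightarrow> norm (c' + z) \<le> L"
    using cluster[of c "2 * sqrt r"] c(1,2) by blast
  define K where "K = 4 * sqrt r"
  define g where "g = a * st a"
  have g: "g \<in> M" "st g = g" using a by (auto simp: g_def)
  have ng: "norm g \<le> 1" using norm_mult_st[OF a(1)] a(2) by (simp add: g_def power_le_one)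
  have gg: "nonneg (g - g * g)"
  proof -
    have "nonneg (1 *\<^sub>R 1 - st a * a)"
      using norm_st_mult[OF a(1)] a by (intro nonneg_norm_minus) (auto simp: power_le_one)
    from nonneg_conj_st[OF this a(1)] show ?thesis by (simp add: g_def algebra_simps)
  qed
  define X where "X = c' * a - b"
  have XM: "X \<in> M" using c' a b by (simp add: X_def)
  \<comment> \<open>The products with \<open>g\<close> are close once the products with \<open>a\<close> are.\<close>
  have est: "(norm ((c' - c m) * g))\<^sup>2 \<le> e * K" if e: "0 \<le> e" "\<And>n. n \<ge> m \<Longrightarrow> norm ((c n - c m) * a) \<le> e" for m e
  proof -
    define u where "u = c' - c m"
    have u: "u \<in> M" using c c' by (simp add: u_def)
    have K0: "0 \<le> K" using r by (simp add: K_def)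
    have nK: "norm (c n - c m) \<le> K" for n
      using norm_triangle_ineq4[of "c n" "c m"] c(2)[of n] c(2)[of m] by (simp add: K_def)
    have uK: "norm u \<le> K"
      unfolding u_def diff_conv_add_uminus using nK c(1) by (intro c'(2)) auto
    \<comment> \<open>Compare upper and lower bounds for \<open>u + t u g\<close>, where \<open>t\<close> amplifies the part of \<open>u\<close> that
      the sequence cannot see.\<close>
    have main: "2 * t * (norm (u * g))\<^sup>2 \<le> K\<^sup>2 + 2 * t * (e * K)" if t: "0 < t" for t
    proof -
      define L where "L = sqrt (K\<^sup>2 + 2 * t * (e * K) + t\<^sup>2 * (norm (u * g))\<^sup>2)"
      have upper: "norm (v + t *\<^sub>R (u * g)) \<le> L"
        if v: "v \<in> M" "norm v \<le> K" "norm (v * a) \<le> e" for v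
      proof -
        have vg: "norm (v * g) \<le> e"
          using norm_mult_ineq[of "v * a" "st a"] v(3) mult_left_le[of "norm (st a)" "norm (v * a)"] a
          by (simp add: g_def mult.assoc)
        have vgu: "norm (v * g * st u) \<le> e * K"
          using norm_mult_ineq[of "v * g" "st u"] mult_mono[OF vg uK] u e(1) by simp
        have ugv: "norm (u * g * st v) \<le> e * K"
          using norm_st[of "v * g * st u"] vgu u v g by (simp add: mult.assoc)
        have "(v + t *\<^sub>R (u * g)) * st (v + t *\<^sub>R (u * g)) =
          v * st v + t *\<^sub>R (v * g * st u) + t *\<^sub>R (u * g * st v) + t\<^sup>2 *\<^sub>R ((u * g) * st (u * g))"
          using u v g by (simp add: algebra_simps power2_eq_square)
        also have "norm \<dots> \<le> norm (v * st v) + t * norm (v * g * st u) + t * norm (u * g * st v)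
            + t\<^sup>2 * norm ((u * g) * st (u * g))"
          using t by (intro order_trans[OF norm_triangle_ineq] add_mono) auto
        also have "\<dots> \<le> K\<^sup>2 + t * (e * K) + t * (e * K) + t\<^sup>2 * (norm (u * g))\<^sup>2"
          using norm_mult_st[OF v(1)] norm_mult_st[of "u * g"] u g v vgu ugv t
          by (intro add_mono mult_left_mono) (auto simp: power_mono)
        also have "norm ((v + t *\<^sub>R (u * g)) * st (v + t *\<^sub>R (u * g))) = (norm (v + t *\<^sub>R (u * g)))\<^sup>2"
          using u v g by (intro norm_mult_st) auto
        finally have "(norm (v + t *\<^sub>R (u * g)))\<^sup>2 \<le> K\<^sup>2 + 2 * t * (e * K) + t\<^sup>2 * (norm (u * g))\<^sup>2"
          by (simp add: mult_ac)
        then show ?thesis unfolding L_def by (rule real_le_rsqrt)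
      qed
      have "norm (c' + (t *\<^sub>R (u * g) - c m)) \<le> L"
      proof (rule c'(2)[of _ m])
        show "t *\<^sub>R (u * g) - c m \<in> M" using u g c by simp
        show "norm (c n + (t *\<^sub>R (u * g) - c m)) \<le> L" if "m \<le> n" for n
          using upper[of "c n - c m"] c(1) nK e(2)[OF that] by (simp add: algebra_simps)
      qed
      then have "norm (u + t *\<^sub>R (u * g)) \<le> L" by (simp add: u_def algebra_simps)
      \<comment> \<open>The lower bound uses \<open>(1 + t g)\<^sup>2 \<ge> 2 t g + t\<^sup>2 g\<^sup>2 \<ge> (2 t + t\<^sup>2) g\<^sup>2\<close>, as \<open>0 \<le> g \<le> 1\<close>.\<close>
      moreover have "(2 * t + t\<^sup>2) * (norm (u * g))\<^sup>2 \<le> (norm (u + t *\<^sub>R (u * g)))\<^sup>2"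
      proof -
        define w where "w = u + t *\<^sub>R (u * g)"
        have w: "w \<in> M" using u g by (simp add: w_def)
        have "w * st w = u * st u + (2 * t) *\<^sub>R (u * g * st u) + t\<^sup>2 *\<^sub>R (u * g * st (u * g))"
          using u g by (simp add: w_def algebra_simps power2_eq_square scaleR_2[symmetric])
        then have "w * st w - (2 * t + t\<^sup>2) *\<^sub>R ((u * g) * st (u * g))
            = u * st u + (2 * t) *\<^sub>R (u * (g - g * g) * st u)"
          using u g by (simp add: algebra_simps)
        moreover have "nonneg (u * st u + (2 * t) *\<^sub>R (u * (g - g * g) * st u))"
          using u gg t by (intro nonneg_add nonneg_scaleR nonneg_mult_st nonneg_conj_st) auto
        ultimately have "norm ((2 * t + t\<^sup>2) *\<^sub>R ((u * g) * st (u * g))) \<le> norm (w * st w)"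
          using u g t by (intro norm_mono nonneg_scaleR nonneg_mult_st) auto
        then show ?thesis
          using norm_mult_st[of "u * g"] norm_mult_st[OF w] u g t by (simp add: w_def)
      qed
      moreover have "(norm (u + t *\<^sub>R (u * g)))\<^sup>2 \<le> L\<^sup>2"
        using \<open>norm (u + t *\<^sub>R (u * g)) \<le> L\<close> by (intro power_mono) auto
      moreover have "L\<^sup>2 = K\<^sup>2 + 2 * t * (e * K) + t\<^sup>2 * (norm (u * g))\<^sup>2"
        unfolding L_def using t e K0 by (intro real_sqrt_pow2) (auto intro!: add_nonneg_nonneg)
      ultimately show ?thesis by (simp add: algebra_simps)
    qed
    show ?thesis unfolding u_def[symmetric]
    proof (rule field_le_epsilon)
      fix d :: real assume d: "0 < d"
      define t where "t = (K\<^sup>2 + 1) / (2 * d)"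
      have t: "0 < t" "K\<^sup>2 \<le> 2 * t * d" using d by (auto simp: t_def add_nonneg_pos)
      have "2 * t * (norm (u * g))\<^sup>2 \<le> 2 * t * (e * K + d)"
        using main[OF t(1)] t(2) by (simp add: algebra_simps)
      then show "(norm (u * g))\<^sup>2 \<le> e * K + d" using t(1) by simp
    qed
  qed
  \<comment> \<open>By \<open>est\<close>, \<open>c m * g\<close> tends to \<open>c' * g\<close>, while \<open>c m * a\<close> tends to \<open>b\<close>.\<close>
  have "X * st a = 0"
  proof -
    have "(\<lambda>m. (c' - c m) * g) \<longlonglongrightarrow> 0"
    proof (rule LIMSEQ_I)
      fix s :: real assume s: "0 < s"
      have K0: "0 \<le> K" using r by (simp add: K_def)
      define e where "e = s\<^sup>2 / (K + 1)"
      have e: "0 < e" "e * K < s\<^sup>2" using s K0 by (auto simp: e_def field_simps add_pos_nonneg)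
      obtain N where N: "norm (c n * a - c m * a) < e" if "n \<ge> N" "m \<ge> N" for m n
        using LIMSEQ_imp_Cauchy[OF c(3)] e(1) unfolding Cauchy_def dist_norm by blast
      have "norm ((c' - c m) * g - 0) < s" if m: "m \<ge> N" for m
      proof -
        have "(norm ((c' - c m) * g))\<^sup>2 \<le> e * K"
          using N m e(1) by (intro est) (auto simp: left_diff_distrib intro: less_imp_le)
        then have "(norm ((c' - c m) * g))\<^sup>2 < s\<^sup>2" using e(2) by simp
        then have "norm ((c' - c m) * g) < s" by (rule power_less_imp_less_base) (use s in simp)
        then show ?thesis by simp
      qed
      then show "\<exists>N. \<forall>m\<ge>N. norm ((c' - c m) * g - 0) < s" by blast
    qed
    moreover have "(\<lambda>m. (c' - c m) * g) \<longlonglongrightarrow> X * st a"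
    proof -
      have "(c' - c m) * g = (c' * a - c m * a) * st a" for m by (simp add: g_def algebra_simps)
      then show ?thesis unfolding X_def using c(3) by (auto intro!: tendsto_intros)
    qed
    ultimately show ?thesis by (rule LIMSEQ_unique[rotated])
  qed
  then have aX: "a * st X = 0"
    using st_mult[of X "st a"] XM a by simp
  \<comment> \<open>The majorization transfers \<open>a X\<^sup>* = 0\<close> to \<open>b\<close>, and both together give \<open>X X\<^sup>* = 0\<close>.\<close>
  have "b * st X = 0"
  proof -
    have "nonneg (r *\<^sub>R (st (a * st X) * (a * st X)) - st (b * st X) * (b * st X))"
      using nonneg_conj[OF ba st_mem[OF XM]] a(1) b XM by (simp add: algebra_simps)
    then have "(norm (b * st X))\<^sup>2 \<le> r * (norm (a * st X))\<^sup>2"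
      using a b XM r by (intro norm_le_of_st_mult_le) auto
    then show ?thesis by (simp add: aX)
  qed
  then have "X * st X = 0"
    using aX by (simp add: X_def algebra_simps)
  then have "X = 0" using norm_mult_st[OF XM] by simp
  with c' show ?thesis by (auto simp: X_def)
qed

end

section \<open>The algebra of bounded operators\<close>

text \<open>The bounded operators on one space as a type of their own, so that composition can be the
multiplication of a ring.  The class constraints below do not include \<open>0 \<noteq> 1\<close>, which fails on the
zero space.\<close>
typedef (overloaded) 'v endo = "UNIV :: ('v::real_normed_vector \<Rightarrow>\<^sub>L 'v) set"
  morphisms blinfun_of Endo ..

setup_lifting type_definition_endo

lift_definition app :: "'v::real_normed_vector endo \<Rightarrow> 'v \<Rightarrow> 'v" is blinfun_apply .

instantiation endo :: (real_normed_vector) "{real_normed_algebra, monoid_mult}"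
begin

lift_definition zero_endo :: "'a endo" is 0 .
lift_definition one_endo :: "'a endo" is id_blinfun .
lift_definition plus_endo :: "'a endo \<Rightarrow> 'a endo \<Rightarrow> 'a endo" is "(+)" .
lift_definition minus_endo :: "'a endo \<Rightarrow> 'a endo \<Rightarrow> 'a endo" is "(-)" .
lift_definition uminus_endo :: "'a endo \<Rightarrow> 'a endo" is uminus .
lift_definition times_endo :: "'a endo \<Rightarrow> 'a endo \<Rightarrow> 'a endo" is "(o\<^sub>L)" .
lift_definition scaleR_endo :: "real \<Rightarrow> 'a endo \<Rightarrow> 'a endo" is "(*\<^sub>R)" .
lift_definition norm_endo :: "'a endo \<Rightarrow> real" is norm .

definition dist_endo :: "'a endo \<Rightarrow> 'a endo \<Rightarrow> real"
  where "dist_endo S T = norm (S - T)"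
definition sgn_endo :: "'a endo \<Rightarrow> 'a endo"
  where "sgn_endo T = inverse (norm T) *\<^sub>R T"
definition uniformity_endo :: "('a endo \<times> 'a endo) filter"
  where "uniformity_endo = (INF e\<in>{0 <..}. principal {(S, T). dist S T < e})"
definition open_endo :: "'a endo set \<Rightarrow> bool"
  where "open_endo U = (\<forall>S\<in>U. \<forall>\<^sub>F (S', T) in uniformity. S' = S \<longrightarrow> T \<in> U)"

instance
proof
  fix R S T :: "'a endo" and r s :: real
  show "R * S * T = R * (S * T)" by transfer (rule blinfun_eqI, simp)
  show "1 * T = T" "T * 1 = T" by (transfer, rule blinfun_eqI, simp)+
  show "(R + S) * T = R * T + S * T" "R * (S + T) = R * S + R * T"
    by (transfer, rule blinfun_eqI, simp add: blinfun.bilinear_simps)+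
  show "r *\<^sub>R S * T = r *\<^sub>R (S * T)" "S * r *\<^sub>R T = r *\<^sub>R (S * T)"
    by (transfer, rule blinfun_eqI, simp add: blinfun.bilinear_simps)+
  show "norm (S * T) \<le> norm S * norm T" by transfer (rule norm_blinfun_compose)
  show "norm (S + T) \<le> norm S + norm T" by transfer (rule norm_triangle_ineq)
  show "norm (r *\<^sub>R S) = \<bar>r\<bar> * norm S" by transfer (rule norm_scaleR)
  show "norm S = 0 \<longleftrightarrow> S = 0" by transfer (rule norm_eq_zero)
  show "R + S + T = R + (S + T)" by transfer (rule add.assoc)
  show "S + T = T + S" by transfer (rule add.commute)
  show "0 + S = S" "- S + S = 0" "S - T = S + - T" by (transfer, simp)+
  show "r *\<^sub>R (S + T) = r *\<^sub>R S + r *\<^sub>R T" by transfer (rule scaleR_add_right)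
  show "(r + s) *\<^sub>R S = r *\<^sub>R S + s *\<^sub>R S" by transfer (rule scaleR_add_left)
  show "r *\<^sub>R s *\<^sub>R S = (r * s) *\<^sub>R S" "1 *\<^sub>R S = S" by (transfer, simp)+
qed (simp_all add: dist_endo_def sgn_endo_def uniformity_endo_def open_endo_def)

end

lemma app_simps [simp]:
  "app 0 x = 0" "app 1 x = x" "app (S + T) x = app S x + app T x"
  "app (S - T) x = app S x - app T x" "app (- T) x = - app T x"
  "app (S * T) x = app S (app T x)" "app (r *\<^sub>R T) x = r *\<^sub>R app T x"
  by (transfer, simp add: blinfun.bilinear_simps)+

lemma endo_eqI: "(\<And>x. app S x = app T x) \<Longrightarrow> S = T"
  by transfer (rule blinfun_eqI)

lemma bounded_linear_app: "bounded_linear (app T)"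
  by transfer (rule blinfun.bounded_linear_right)

lemma norm_app: "norm (app T x) \<le> norm T * norm x"
  by transfer (rule norm_blinfun)

lemma norm_endo_bound: "0 \<le> b \<Longrightarrow> (\<And>x. norm (app T x) \<le> b * norm x) \<Longrightarrow> norm T \<le> b"
  by transfer (rule norm_blinfun_bound)

lemma norm_endo_eq_onorm: "norm T = onorm (app T)"
  by transfer (rule norm_blinfun.rep_eq)

lemma bounded_linear_app_left: "bounded_linear (\<lambda>T. app T x)"
proof (rule bounded_linear_intro)
  show "norm (app T x) \<le> norm T * norm x" for T :: "'a endo" by (rule norm_app)
qed auto

lift_definition endo_of :: "('v::real_normed_vector \<Rightarrow> 'v) \<Rightarrow> 'v endo" is Blinfun .

lemma app_endo_of: "bounded_linear f \<Longrightarrow> app (endo_of f) = f"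
  by transfer (rule bounded_linear_Blinfun_apply)

lemma endo_of_app [simp]: "endo_of (app T) = T"
  by (rule endo_eqI) (simp add: app_endo_of bounded_linear_app)

instance endo :: (banach) banach
proof
  fix X :: "nat \<Rightarrow> 'a endo"
  assume X: "Cauchy X"
  have eq: "dist (blinfun_of S) (blinfun_of T) = dist S T" for S T :: "'a endo"
    unfolding dist_norm by transfer simp
  have "Cauchy (\<lambda>n. blinfun_of (X n))"
    using X unfolding Cauchy_def eq .
  then obtain L where "(\<lambda>n. blinfun_of (X n)) \<longlonglongrightarrow> L"
    using Cauchy_convergent convergent_def by blast
  then have "(\<lambda>n. blinfun_of (X n)) \<longlonglongrightarrow> blinfun_of (Endo L)" by (simp add: Endo_inverse)
  then have "X \<longlonglongrightarrow> Endo L" unfolding lim_sequentially eq .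
  then show "convergent X" by (rule convergentI)
qed

instance complex_banach \<subseteq> banach ..

section \<open>Modules with a Cauchy-Schwarz inequality\<close>

lemma scaleC_scaleR: "c *\<^sub>C (r *\<^sub>R x) = r *\<^sub>R (c *\<^sub>C (x::'v::complex_normed_vector))"
  by (simp add: scaleC_of_real[symmetric] scaleC_scaleC mult.commute)

lemma bounded_linear_scaleC: "bounded_linear ((*\<^sub>C) c :: 'v::complex_normed_vector \<Rightarrow> 'v)"
  by (rule bounded_linear_intro[where K="cmod c"])
    (simp_all add: scaleC_add_right scaleC_scaleR norm_scaleC mult.commute)

lemma scaleC_minus_one: "(-1) *\<^sub>C (x::'v::complex_normed_vector) = - x"
  using scaleC_of_real[of "-1" x] by simp

lemma star_norm [simp]: "norm (star (a::'a::cstar_algebra)) = norm a"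
proof -
  have le: "norm b \<le> norm (star b)" for b :: 'a
  proof (cases "norm b = 0")
    case False
    have "norm b * norm b \<le> norm (star b) * norm b"
      using cstar_identity[of b] norm_mult_ineq[of "star b" b] by (simp add: power2_eq_square)
    then show ?thesis using False by simp
  qed simp
  from le[of a] le[of "star a"] show ?thesis by (simp add: star_star)
qed

locale semi_inner =
  fixes ip :: "'v::complex_banach \<Rightarrow> 'v \<Rightarrow> 'c::cstar_algebra"
  assumes add_right: "ip x (y + z) = ip x y + ip x z"
    and scaleC_right: "ip x (c *\<^sub>C y) = c *\<^sub>C ip x y"
    and star_ip: "star (ip x y) = ip y x"
begin

lemma add_left: "ip (x + y) z = ip x z + ip y z"
  by (metis add_right star_add star_ip)

lemma scaleC_left: "ip (c *\<^sub>C x) y = cnj c *\<^sub>C ip x y"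
  by (metis scaleC_right star_ip star_scaleC)

lemma scaleR_right: "ip x (r *\<^sub>R y) = r *\<^sub>R ip x y"
  using scaleC_right[of x "complex_of_real r" y] by (simp add: scaleC_of_real)

lemma scaleR_left: "ip (r *\<^sub>R x) y = r *\<^sub>R ip x y"
  using scaleC_left[of "complex_of_real r" x y] by (simp add: scaleC_of_real)

lemma minus_right: "ip x (- y) = - ip x y"
  using scaleR_right[of x "-1" y] by simp

lemma minus_left: "ip (- x) y = - ip x y"
  using scaleR_left[of "-1" x y] by simp

lemma diff_right: "ip x (y - z) = ip x y - ip x z"
  using add_right[of x y "- z"] by (simp add: minus_right)

lemma diff_left: "ip (x - y) z = ip x z - ip y z"
  using add_left[of x "- y" z] by (simp add: minus_left)

lemma zero_right [simp]: "ip x 0 = 0"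
  using scaleR_right[of x 0 0] by simp

lemma zero_left [simp]: "ip 0 x = 0"
  using scaleR_left[of 0 0 x] by simp

lemmas ip_linear = add_right add_left scaleR_right scaleR_left diff_right diff_left

end

text \<open>What makes the adjointable operators a C*-algebra is the Cauchy-Schwarz inequality.  A Hilbert module
satisfies it, but the proof uses the order of the coefficient algebra.  That order comes from the
instance of this locale in which the algebra is a module over itself, where the inequality is
immediate.\<close>
locale cauchy_schwarz_module = semi_inner ip
  for ip :: "'v::complex_banach \<Rightarrow> 'v \<Rightarrow> 'c::cstar_algebra" +
  assumes norm_ip_le: "norm (ip x y) \<le> norm x * norm y"
    and norm_ip_self: "norm (ip x x) = (norm x)\<^sup>2"
begin

lemma bounded_linear_right: "bounded_linear (ip x)"
  by (rule bounded_linear_intro[where K="norm x"])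
    (simp_all add: add_right scaleR_right norm_ip_le mult.commute[of _ "norm x"])

lemma bounded_linear_left: "bounded_linear (\<lambda>x. ip x y)"
  by (rule bounded_linear_intro[where K="norm y"])
    (simp_all add: add_left scaleR_left norm_ip_le)

lemma ip_self_eq_0: "ip x x = 0 \<Longrightarrow> x = 0"
  using norm_ip_self[of x] by simp

lemma eq_of_ip_left: "(\<And>z. ip z x = ip z y) \<Longrightarrow> x = y"
  using ip_self_eq_0[of "x - y"] by (simp add: diff_right)

definition adj :: "('v \<Rightarrow> 'v) \<Rightarrow> ('v \<Rightarrow> 'v) \<Rightarrow> bool" where
  "adj T S \<longleftrightarrow> (\<forall>x y. ip (T x) y = ip x (S y))"

lemma adj_sym: "adj T S \<Longrightarrow> adj S T"
  unfolding adj_def by (metis star_ip)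

lemma adj_unique: "adj T S \<Longrightarrow> adj T S' \<Longrightarrow> S = S'"
  unfolding adj_def by (metis eq_of_ip_left ext)

definition ops :: "'v endo set" where
  "ops = {T. \<exists>S. adj (app T) (app S)}"

definition adjoint :: "'v endo \<Rightarrow> 'v endo" where
  "adjoint T = (THE S. adj (app T) (app S))"

lemma adjoint_eqI: "adj (app T) (app S) \<Longrightarrow> adjoint T = S"
  unfolding adjoint_def
  by (rule the_equality) (auto, metis adj_unique endo_of_app)

lemma ops_adj: "T \<in> ops \<Longrightarrow> adj (app T) (app (adjoint T))"
  using adjoint_eqI by (auto simp: ops_def)

lemma opsI: "adj (app T) (app S) \<Longrightarrow> T \<in> ops"
  by (auto simp: ops_def)

definition imag_unit :: "'v endo" where
  "imag_unit = endo_of ((*\<^sub>C) \<i>)"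

lemma app_imag_unit [simp]: "app imag_unit x = \<i> *\<^sub>C x"
  by (simp add: imag_unit_def app_endo_of bounded_linear_scaleC)

lemma adj_scaleC:
  assumes "adj T S"
  shows "T (c *\<^sub>C x) = c *\<^sub>C T x"
proof (rule eq_of_ip_left)
  from adj_sym[OF assms] have "ip z (T y) = ip (S z) y" for z y by (simp add: adj_def)
  then show "ip z (T (c *\<^sub>C x)) = ip z (c *\<^sub>C T x)" for z by (simp add: scaleC_right)
qed

lemma adj_rules:
  "adj (app S) (app S') \<Longrightarrow> adj (app T) (app T') \<Longrightarrow> adj (app (S + T)) (app (S' + T'))"
  "adj (app S) (app S') \<Longrightarrow> adj (app T) (app T') \<Longrightarrow> adj (app (S * T)) (app (T' * S'))"
  "adj (app S) (app S') \<Longrightarrow> adj (app (r *\<^sub>R S)) (app (r *\<^sub>R S'))"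
  "adj (app 1) (app 1)"
  "adj (app imag_unit) (app (- imag_unit))"
  by (simp_all add: adj_def ip_linear minus_right scaleC_left scaleC_right)
    (simp add: scaleC_minus_one[symmetric] scaleC_scaleC)

text \<open>Both inequalities compare \<open>\<parallel>T x\<parallel>\<^sup>2 = \<parallel>\<langle>x, T\<^sup>* T x\<rangle>\<parallel>\<close> with norms by Cauchy-Schwarz; the first one needs
\<open>\<parallel>T\<^sup>*\<parallel> \<le> \<parallel>T\<parallel>\<close>, which is obtained from \<open>\<parallel>T\<^sup>* x\<parallel>\<^sup>2 = \<parallel>\<langle>T (T\<^sup>* x), x\<rangle>\<parallel>\<close>.\<close>
lemma norm_adjoint_mult:
  assumes T: "T \<in> ops"
  shows "norm (adjoint T * T) = (norm T)\<^sup>2"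
proof (rule antisym)
  define S where "S = adjoint T"
  have adj: "ip (app T x) y = ip x (app S y)" for x y
    using ops_adj[OF T] by (simp add: adj_def S_def)
  have "norm S \<le> norm T"
  proof (rule norm_endo_bound)
    fix x
    show "norm (app S x) \<le> norm T * norm x"
    proof (cases "app S x = 0")
      case False
      have "(norm (app S x))\<^sup>2 = norm (ip (app T (app S x)) x)"
        by (simp add: adj norm_ip_self)
      also have "\<dots> \<le> (norm T * norm (app S x)) * norm x"
        by (intro order_trans[OF norm_ip_le] mult_right_mono norm_app) auto
      finally show ?thesis using False by (simp add: power2_eq_square)
    qed simp
  qed simp
  then have "norm S * norm T \<le> norm T * norm T" by (intro mult_right_mono) auto
  then show "norm (adjoint T * T) \<le> (norm T)\<^sup>2"
    using norm_mult_ineq[of S T] by (simp add: S_def power2_eq_square)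
  have "norm T \<le> sqrt (norm (S * T))"
  proof (rule norm_endo_bound)
    fix x
    have "(norm (app T x))\<^sup>2 = norm (ip x (app (S * T) x))"
      by (simp add: adj[symmetric] norm_ip_self)
    also have "\<dots> \<le> norm x * (norm (S * T) * norm x)"
      by (intro order_trans[OF norm_ip_le] mult_left_mono norm_app) auto
    also have "\<dots> = (sqrt (norm (S * T)) * norm x)\<^sup>2"
      by (simp add: power_mult_distrib power2_eq_square)
    finally show "norm (app T x) \<le> sqrt (norm (S * T)) * norm x"
      by (rule power2_le_imp_le) simp
  qed simp
  then show "(norm T)\<^sup>2 \<le> norm (adjoint T * T)"
    using real_le_rsqrt real_sqrt_le_iff sqrt_ge_absD by (simp add: S_def sqrt_ge_absD)
qed

sublocale unital_cstar ops adjoint imag_unit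
proof
  show "1 \<in> ops" "imag_unit \<in> ops" using adj_rules(4,5) by (auto intro: opsI)
  fix S T assume S: "S \<in> ops" and T: "T \<in> ops"
  show "S + T \<in> ops" "S * T \<in> ops" "adjoint (S + T) = adjoint S + adjoint T"
    "adjoint (S * T) = adjoint T * adjoint S"
    using adj_rules(1,2)[OF ops_adj[OF S] ops_adj[OF T]] by (auto intro: opsI adjoint_eqI)
next
  fix T and r :: real assume T: "T \<in> ops"
  show "r *\<^sub>R T \<in> ops" "adjoint (r *\<^sub>R T) = r *\<^sub>R adjoint T"
    using adj_rules(3)[OF ops_adj[OF T]] by (auto intro: opsI adjoint_eqI)
  show "adjoint T \<in> ops" "adjoint (adjoint T) = T"
    using adj_sym[OF ops_adj[OF T]] by (auto intro: opsI adjoint_eqI)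
  show "imag_unit * T = T * imag_unit"
    by (rule endo_eqI) (simp add: adj_scaleC[OF ops_adj[OF T]])
  show "norm (adjoint T * T) = (norm T)\<^sup>2" using T by (rule norm_adjoint_mult)
next
  show "adjoint imag_unit = - imag_unit" using adj_rules(5) by (rule adjoint_eqI)
  show "imag_unit * imag_unit = - 1"
    by (rule endo_eqI) (simp add: scaleC_scaleC scaleC_minus_one)
  have "{T \<in> ops. adjoint T = T} = {T. adj (app T) (app T)}"
    using ops_adj by (auto intro: opsI adjoint_eqI) (metis ops_adj)
  also have "\<dots> = (\<Inter>x. \<Inter>y. {T. ip (app T x) y = ip x (app T y)})"
    by (auto simp: adj_def)
  also have "closed \<dots>"
    by (intro closed_INT ballI closed_Collect_eq
        bounded_linear.continuous_on[OF bounded_linear_left]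
        bounded_linear.continuous_on[OF bounded_linear_right]
        bounded_linear.continuous_on[OF bounded_linear_app_left] continuous_on_id)
  finally show "closed {T \<in> ops. adjoint T = T}" .
qed

end

section \<open>Cauchy-Schwarz in a Hilbert module\<close>

interpretation self: cauchy_schwarz_module "\<lambda>a b. star a * (b :: 'a::cstar_algebra)"
proof
  fix x y z :: 'a and c
  show "star x * (y + z) = star x * y + star x * z" by (simp add: algebra_simps)
  show "star x * c *\<^sub>C y = c *\<^sub>C (star x * y)" by (rule mult_scaleC_right)
  show "star (star x * y) = star y * x" by (simp add: star_mult star_star)
  show "norm (star x * y) \<le> norm x * norm y" using norm_mult_ineq[of "star x" y] by simp
  show "norm (star x * x) = (norm x)\<^sup>2" by (rule cstar_identity)
qed

text \<open>Left multiplication embeds the coefficient algebra isometrically into the unital algebra of its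
adjointable operators, which replaces the adjunction of a unit.\<close>
definition left_mult :: "'a::cstar_algebra \<Rightarrow> 'a endo" where
  "left_mult a = endo_of ((*) a)"

lemma app_left_mult [simp]: "app (left_mult a) x = a * x"
  by (simp add: left_mult_def app_endo_of bounded_linear_mult_right)

lemma left_mult_algebra:
  "left_mult (a + b) = left_mult a + left_mult b"
  "left_mult (a - b) = left_mult a - left_mult b"
  "left_mult (a * b) = left_mult a * left_mult b"
  "left_mult (r *\<^sub>R a) = r *\<^sub>R left_mult a"
  by (rule endo_eqI, simp add: algebra_simps)+

lemma left_mult_mem [simp]: "left_mult a \<in> self.ops"
  and adjoint_left_mult [simp]: "self.adjoint (left_mult a) = left_mult (star a)"
proof -
  have "self.adj (app (left_mult a)) (app (left_mult (star a)))"
    by (simp add: self.adj_def star_mult mult.assoc)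
  then show "left_mult a \<in> self.ops" "self.adjoint (left_mult a) = left_mult (star a)"
    by (auto intro: self.opsI self.adjoint_eqI)
qed

lemma norm_left_mult [simp]: "norm (left_mult a) = norm a"
proof (rule antisym)
  show "norm (left_mult a) \<le> norm a"
    by (rule norm_endo_bound) (auto simp: norm_mult_ineq)
  show "norm a \<le> norm (left_mult a)"
  proof (cases "a = 0")
    case False
    have "norm a * norm a \<le> norm (left_mult a) * norm a"
      using norm_app[of "left_mult a" "star a"] cstar_identity[of "star a"]
      by (simp add: star_star power2_eq_square)
    then show ?thesis using False by simp
  qed simp
qed

lemma nonneg_left_mult:
  assumes "cstar_positive a"
  shows "self.nonneg (left_mult a)"
proof -
  from assms obtain b where "a = star b * b" by (auto simp: cstar_positive_def)
  then show ?thesis using self.nonneg_st_mult[of "left_mult b"] by (simp add: left_mult_algebra)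
qed

text \<open>Let \<open>a = \<langle>x, y\<rangle>\<close>, \<open>k = \<parallel>x\<parallel>\<^sup>2\<close> and \<open>w = x a - k y\<close>.  Expanding \<open>\<langle>w, w\<rangle> \<ge> 0\<close> and using
\<open>a\<^sup>* \<langle>x, x\<rangle> a \<le> k a\<^sup>* a\<close> gives \<open>k a\<^sup>* a \<le> k\<^sup>2 \<langle>y, y\<rangle>\<close>; then take norms.\<close>
lemma hilbert_cstar_module_cauchy_schwarz:
  assumes "hilbert_cstar_module ip act"
  shows "cauchy_schwarz_module ip"
proof -
  interpret hilbert_cstar_module ip act by fact
  interpret semi_inner ip
    by standard (simp_all add: ip_add_right ip_scaleC_right ip_star)
  have sq: "norm (ip x x) = (norm x)\<^sup>2" for x by (simp add: norm_eq_ip)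
  have act_left: "ip (act x a) y = star a * ip x y" for x a y
    by (metis ip_act_right ip_star star_mult)
  have "norm (ip x y) \<le> norm x * norm y" for x y
  proof (cases "x = 0")
    case False
    define a where "a = ip x y"
    define k where "k = (norm x)\<^sup>2"
    have k: "0 < k" using False by (simp add: k_def)
    define w where "w = act x a - k *\<^sub>R y"
    have "ip w w = star a * ip x x * a - (2 * k) *\<^sub>R (star a * a) + (k * k) *\<^sub>R ip y y"
    proof -
      have "ip y x = star a" by (simp add: a_def ip_star)
      then show ?thesis
        by (simp add: w_def ip_linear act_left ip_act_right a_def[symmetric] algebra_simps scaleR_2 mult.assoc
            flip: scaleR_scaleR)
    qed
    then have w: "left_mult (ip w w) = self.adjoint (left_mult a) * left_mult (ip x x) * left_mult a
        - (2 * k) *\<^sub>R (self.adjoint (left_mult a) * left_mult a) + (k * k) *\<^sub>R left_mult (ip y y)"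
      by (simp add: left_mult_algebra)
    have "self.nonneg (k *\<^sub>R 1 - left_mult (ip x x))"
      using self.nonneg_st[OF nonneg_left_mult[OF ip_positive[of x]]]
      by (intro self.nonneg_norm_minus) (simp_all add: sq k_def)
    then have "self.nonneg (self.adjoint (left_mult a) * (k *\<^sub>R 1 - left_mult (ip x x)) * left_mult a)"
      by (rule self.nonneg_conj) simp
    from self.nonneg_add[OF this nonneg_left_mult[OF ip_positive[of w]]]
    have "self.nonneg ((k * k) *\<^sub>R left_mult (ip y y) - k *\<^sub>R (self.adjoint (left_mult a) * left_mult a))"
      unfolding w by (simp add: algebra_simps scaleR_2 del: self.st_mult adjoint_left_mult flip: scaleR_scaleR)
    moreover have "self.nonneg (k *\<^sub>R (self.adjoint (left_mult a) * left_mult a))"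
      using k by (intro self.nonneg_scaleR self.nonneg_st_mult) simp_all
    ultimately have "norm (k *\<^sub>R (self.adjoint (left_mult a) * left_mult a)) \<le> norm ((k * k) *\<^sub>R left_mult (ip y y))"
      by (intro self.norm_mono)
    then have "k * (norm a)\<^sup>2 \<le> k * k * (norm y)\<^sup>2"
      using k self.norm_st_mult[of "left_mult a"] by (simp add: sq)
    then have "(norm a)\<^sup>2 \<le> k * (norm y)\<^sup>2"
      using mult_le_cancel_left_pos[OF k, of "(norm a)\<^sup>2"] by (simp add: mult.assoc)
    then have "(norm a)\<^sup>2 \<le> (norm x * norm y)\<^sup>2"
      by (simp add: k_def power_mult_distrib)
    then show ?thesis unfolding a_def by (rule power2_le_imp_le) simp
  qed simp
  then show ?thesis by unfold_locales (simp_all add: sq)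
qed

section \<open>Boundedness of adjointable operators\<close>

context cauchy_schwarz_module
begin

text \<open>The uniform boundedness principle for the functionals \<open>\<langle>w, \<cdot>\<rangle>\<close>: by Baire's theorem one of the closed
sets \<open>F n\<close> contains a ball, and \<open>w\<close> itself is the direction in which \<open>\<langle>w, \<cdot>\<rangle>\<close> attains its norm.\<close>
lemma bounded_of_pointwise_bounded:
  assumes W: "\<And>x. \<exists>K. \<forall>w\<in>W. norm (ip w x) \<le> K"
  shows "\<exists>K. \<forall>w\<in>W. norm w \<le> K"
proof -
  define F where "F n = {x. \<forall>w\<in>W. norm (ip w x) \<le> real n}" for n
  have closed_F: "closed (F n)" for n
  proof -
    have "F n = (\<Inter>w\<in>W. {x. norm (ip w x) \<le> real n})" by (auto simp: F_def)
    also have "closed \<dots>"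
      by (intro closed_INT ballI closed_Collect_le continuous_on_norm continuous_on_const
          bounded_linear.continuous_on[OF bounded_linear_right] continuous_on_id)
    finally show ?thesis .
  qed
  have "x \<in> \<Union>(range F)" for x
  proof -
    obtain K where "\<forall>w\<in>W. norm (ip w x) \<le> K" using W by blast
    then have "x \<in> F (nat \<lceil>K\<rceil>)"
      unfolding F_def using real_nat_ceiling_ge[of K] by (auto intro: order_trans)
    then show ?thesis by blast
  qed
  then have cover: "\<Union>(range F) = UNIV" by blast
  obtain n where "interior (F n) \<noteq> {}"
  proof (rule ccontr)
    assume "\<not> thesis"
    then have "interior (F n) = {}" for n using that by blast
    then have "(euclidean interior_of \<Union>(range F) :: 'v set) = {}"
      using Met_TC.metric_Baire_category_alt[of "range F"] closed_F complete_UNIV by auto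
    then show False by (simp add: cover)
  qed
  then obtain x0 e where e: "0 < e" "cball x0 e \<subseteq> F n"
    by (metis all_not_in_conv mem_interior_cball)
  have "norm w \<le> 2 * real n / e" if w: "w \<in> W" for w
  proof (cases "w = 0")
    case False
    define h where "h = (e / norm w) *\<^sub>R w"
    have "x0 \<in> F n" "x0 + h \<in> F n" using e False by (auto simp: h_def dist_norm intro!: subsetD[OF e(2)])
    then have "norm (ip w x0) \<le> real n" "norm (ip w (x0 + h)) \<le> real n"
      using w by (auto simp: F_def)
    moreover have "ip w h = ip w (x0 + h) - ip w x0" by (simp add: add_right)
    ultimately have "norm (ip w h) \<le> 2 * real n"
      using norm_triangle_ineq4[of "ip w (x0 + h)" "ip w x0"] by simp
    moreover have "norm (ip w h) = e * norm w"
      using e False by (simp add: h_def scaleR_right norm_ip_self power2_eq_square)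
    ultimately show ?thesis using e by (simp add: field_simps)
  qed (use e in simp)
  then show ?thesis by blast
qed

text \<open>Linearity is tested against the inner product.  The images of the unit ball are pointwise bounded,
as \<open>\<langle>T y, x\<rangle> = \<langle>y, S x\<rangle>\<close>.\<close>
lemma adj_bounded_linear:
  assumes adj: "adj T S"
  shows "bounded_linear T"
proof -
  have ST: "ip (S z) x = ip z (T x)" for x z
    using adj_sym[OF adj] by (simp add: adj_def)
  have T_scaleR: "T (r *\<^sub>R x) = r *\<^sub>R T x" for r x
    by (rule eq_of_ip_left) (simp add: ST[symmetric] scaleR_right)
  have T_add: "T (x + y) = T x + T y" for x y
    by (rule eq_of_ip_left) (simp add: ST[symmetric] add_right)
  have "\<exists>K. \<forall>w\<in>T ` cball 0 1. norm w \<le> K"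
  proof (rule bounded_of_pointwise_bounded)
    fix x
    have "norm (ip (T y) x) \<le> norm (S x)" if "norm y \<le> 1" for y
    proof -
      have "norm (ip (T y) x) = norm (ip y (S x))" using adj by (simp add: adj_def)
      also have "\<dots> \<le> 1 * norm (S x)"
        using norm_ip_le that by (meson mult_right_mono norm_ge_zero order_trans)
      finally show ?thesis by simp
    qed
    then show "\<exists>K. \<forall>w\<in>T ` cball 0 1. norm (ip w x) \<le> K"
      by (intro exI[of _ "norm (S x)"]) auto
  qed
  then obtain K where "\<forall>w\<in>T ` cball 0 1. norm w \<le> K" ..
  then have K: "norm (T y) \<le> K" if "norm y \<le> 1" for y using that by simp
  have "norm (T y) \<le> norm y * K" for y
  proof (cases "y = 0")
    case True
    then show ?thesis using T_scaleR[of 0 y] by simp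
  next
    case False
    then show ?thesis
      using K[of "(1 / norm y) *\<^sub>R y"] by (simp add: T_scaleR field_simps)
  qed
  then show ?thesis by (intro bounded_linear_intro T_add T_scaleR)
qed

lemma adj_endo_of:
  assumes "adj T S"
  shows "endo_of T \<in> ops" "app (endo_of T) = T" "app (adjoint (endo_of T)) = S"
proof -
  have app: "app (endo_of T) = T" "app (endo_of S) = S"
    using adj_bounded_linear[OF assms] adj_bounded_linear[OF adj_sym[OF assms]]
    by (simp_all add: app_endo_of)
  with assms have "adj (app (endo_of T)) (app (endo_of S))" by simp
  with app show "endo_of T \<in> ops" "app (endo_of T) = T" "app (adjoint (endo_of T)) = S"
    using adjoint_eqI[of "endo_of T" "endo_of S"] opsI[of "endo_of T" "endo_of S"] by simp_all
qed

lemma adjointable_ops_eq: "adjointable_ops ip = app ` ops"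
proof (intro equalityI subsetI)
  fix T assume "T \<in> adjointable_ops ip"
  then obtain S where "adj T S" by (auto simp: adjointable_ops_def adj_def)
  from adj_endo_of(1,2)[OF this] show "T \<in> app ` ops" by (metis imageI)
next
  fix T assume "T \<in> app ` ops"
  then show "T \<in> adjointable_ops ip" by (auto simp: adjointable_ops_def ops_def adj_def)
qed

lemma module_adjoint_app:
  assumes "T \<in> ops"
  shows "module_adjoint ip (app T) = app (adjoint T)"
  unfolding module_adjoint_def adj_def[symmetric]
  by (rule the_equality) (use ops_adj[OF assms] adj_unique in blast)+

lemma op_positive_app:
  "op_positive ip (app T) \<longleftrightarrow> (\<exists>S\<in>ops. T = adjoint S * S)"
proof -
  have "app T = module_adjoint ip (app S) \<circ> app S \<longleftrightarrow> T = adjoint S * S" if "S \<in> ops" for S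
  proof -
    have "module_adjoint ip (app S) \<circ> app S = app (adjoint S * S)"
      using that by (auto simp: module_adjoint_app)
    then show ?thesis by (metis endo_of_app)
  qed
  then show ?thesis by (simp add: op_positive_def adjointable_ops_eq)
qed

section \<open>Factorization from range inclusion\<close>

text \<open>Any choice of preimages \<open>C x\<close> of \<open>B x\<close> satisfies \<open>\<langle>C x, A\<^sup>* y\<rangle> = \<langle>x, B\<^sup>* y\<rangle>\<close>.  Uniform boundedness turns
this into \<open>\<parallel>B\<^sup>* y\<parallel> \<le> K \<parallel>A\<^sup>* y\<parallel>\<close>.  So when \<open>A\<^sup>* y\<^sub>n\<close> converges to \<open>z\<close>, the sequence \<open>B\<^sup>* y\<^sub>n\<close> converges,
and its limit is the value at \<open>z\<close> of an adjoint of \<open>C\<close>.  That \<open>C\<close> is linear and bounded follows from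
its having an adjoint.\<close>
lemma factor_of_range_subset:
  assumes A: "A \<in> ops" and B: "B \<in> ops"
    and dense: "closure (range (app (adjoint A))) = UNIV"
    and range: "range (app B) \<subseteq> range (app A)"
  obtains C where "C \<in> ops" "B = A * C"
proof -
  define A' where "A' = app (adjoint A)"
  define B' where "B' = app (adjoint B)"
  have "\<exists>z. app A z = app B x" for x
    using subsetD[OF range rangeI[of "app B" x]] by (auto elim: rangeE dest: sym)
  then obtain C where C: "\<And>x. app A (C x) = app B x" by metis
  have A': "ip (app A x) y = ip x (A' y)" and B': "ip (app B x) y = ip x (B' y)" for x y
    using ops_adj[OF A] ops_adj[OF B] by (simp_all add: adj_def A'_def B'_def)
  have CA: "ip (C x) (A' y) = ip x (B' y)" for x y
    by (simp add: A'[symmetric] B'[symmetric] C)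
  then have AC: "ip (A' y) (C x) = ip (B' y) x" for x y by (metis star_ip)
  have A'_lin: "bounded_linear A'" and B'_lin: "bounded_linear B'"
    by (simp_all add: A'_def B'_def bounded_linear_app)
  have "\<exists>K. \<forall>w\<in>B' ` {y. norm (A' y) \<le> 1}. norm w \<le> K"
  proof (rule bounded_of_pointwise_bounded)
    fix x
    have "norm (ip (B' y) x) \<le> norm (C x)" if "norm (A' y) \<le> 1" for y
    proof -
      have "norm (ip (B' y) x) \<le> norm (A' y) * norm (C x)"
        using norm_ip_le[of "A' y" "C x"] by (simp add: AC)
      also have "\<dots> \<le> 1 * norm (C x)" using that by (intro mult_right_mono) auto
      finally show ?thesis by simp
    qed
    then show "\<exists>K. \<forall>w\<in>B' ` {y. norm (A' y) \<le> 1}. norm (ip w x) \<le> K" by auto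
  qed
  then obtain K where K: "\<And>y. norm (A' y) \<le> 1 \<Longrightarrow> norm (B' y) \<le> K" by auto
  have K': "norm (B' y) \<le> K * norm (A' y)" for y
  proof (cases "A' y = 0")
    case True
    then have "ip (B' y) (B' y) = 0" using AC[of y "B' y"] by simp
    then show ?thesis using ip_self_eq_0 True by force
  next
    case False
    then show ?thesis
      using K[of "(1 / norm (A' y)) *\<^sub>R y"]
      by (simp add: linear_simps(5)[OF A'_lin] linear_simps(5)[OF B'_lin] field_simps)
  qed
  have "\<exists>w. \<forall>x. ip (C x) z = ip x w" for z
  proof -
    have "z \<in> closure (range A')" using dense by (simp add: A'_def)
    then obtain u where u: "\<And>n. u n \<in> range A'" "u \<longlonglongrightarrow> z" unfolding closure_sequential by blast
    have "\<exists>y. u n = A' y" for n using u(1)[of n] by blast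
    then obtain y where "\<And>n. u n = A' (y n)" by metis
    then have y: "u = (\<lambda>n. A' (y n))" by blast
    have "Cauchy (\<lambda>n. B' (y n))"
    proof (rule CauchyI)
      fix e :: real assume e: "0 < e"
      have K0: "0 < \<bar>K\<bar> + 1" by simp
      obtain N where N: "norm (u m - u n) < e / (\<bar>K\<bar> + 1)" if "m \<ge> N" "n \<ge> N" for m n
        using LIMSEQ_imp_Cauchy[OF u(2)] divide_pos_pos[OF e K0] unfolding Cauchy_def dist_norm by blast
      have "norm (B' (y m) - B' (y n)) < e" if mn: "m \<ge> N" "n \<ge> N" for m n
      proof -
        have "norm (B' (y m) - B' (y n)) \<le> K * norm (u m - u n)"
          using K'[of "y m - y n"]
          by (simp add: y linear_simps(2)[OF A'_lin] linear_simps(2)[OF B'_lin])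
        also have "\<dots> \<le> (\<bar>K\<bar> + 1) * norm (u m - u n)" by (intro mult_right_mono) auto
        also have "\<dots> < e" using N[OF mn] K0 by (simp add: pos_less_divide_eq mult.commute)
        finally show ?thesis .
      qed
      then show "\<exists>N. \<forall>m\<ge>N. \<forall>n\<ge>N. norm (B' (y m) - B' (y n)) < e" by blast
    qed
    then obtain w where w: "(\<lambda>n. B' (y n)) \<longlonglongrightarrow> w"
      using Cauchy_convergent convergent_def by blast
    have "ip (C x) z = ip x w" for x
    proof (rule LIMSEQ_unique)
      show "(\<lambda>n. ip (C x) (u n)) \<longlonglongrightarrow> ip (C x) z"
        by (rule bounded_linear.tendsto[OF bounded_linear_right u(2)])
      show "(\<lambda>n. ip (C x) (u n)) \<longlonglongrightarrow> ip x w"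
        unfolding y CA by (rule bounded_linear.tendsto[OF bounded_linear_right w])
    qed
    then show ?thesis by blast
  qed
  then obtain D where "\<And>z x. ip (C x) z = ip x (D z)" by metis
  then have "adj C D" by (simp add: adj_def)
  note C' = adj_endo_of(1,2)[OF this]
  have "B = A * endo_of C" by (rule endo_eqI) (simp add: C' C)
  with C'(1) show ?thesis by (rule that)
qed

section \<open>Cluster points in a dual space\<close>

text \<open>The argument of Banach and Alaoglu: as functions on the predual, the \<open>c n\<close> lie in a product of discs,
which is compact by Tychonoff's theorem.  A cluster point \<open>f\<close> in the topology of pointwise
convergence is again a bounded linear functional, hence represented by an operator, and the inequality
\<open>\<bar>(c n + z) p\<bar> \<le> L \<parallel>p\<parallel>\<close> passes to the limit for each \<open>p\<close> of the predual.\<close>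
lemma ball_cluster_point:
  fixes c :: "nat \<Rightarrow> 'v endo"
  assumes W: "is_W_star_algebra TYPE('p::complex_banach) (adjointable_ops ip)"
    and c: "\<And>n. c n \<in> ops" "\<And>n. norm (c n) \<le> K"
  shows "\<exists>c'\<in>ops. \<forall>z\<in>ops. \<forall>L. \<forall>m. (\<forall>n\<ge>m. norm (c n + z) \<le> L) \<longrightarrow> norm (c' + z) \<le> L"
proof -
  from W obtain \<Phi> :: "('v \<Rightarrow> 'v) \<Rightarrow> 'p \<Rightarrow> complex" where
    \<Phi>: "bij_betw \<Phi> (app ` ops) dual_space \<and>
      (\<forall>S\<in>app ` ops. \<forall>T\<in>app ` ops. \<Phi> (\<lambda>x. S x + T x) = (\<lambda>p. \<Phi> S p + \<Phi> T p)) \<and>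
      (\<forall>c. \<forall>T\<in>app ` ops. \<Phi> (\<lambda>x. c *\<^sub>C T x) = (\<lambda>p. c * \<Phi> T p)) \<and>
      (\<forall>T\<in>app ` ops. onorm (\<Phi> T) = onorm T)"
    unfolding is_W_star_algebra_def adjointable_ops_eq by (rule exE)
  then have bij: "bij_betw \<Phi> (app ` ops) dual_space" by (rule conjunct1)
  have add: "\<Phi> (\<lambda>x. app S x + app T x) = (\<lambda>p. \<Phi> (app S) p + \<Phi> (app T) p)"
    and iso: "onorm (\<Phi> (app T)) = onorm (app T)" if "S \<in> ops" "T \<in> ops" for S T
    using \<Phi> imageI[OF that(1), of app] imageI[OF that(2), of app] by (elim conjE, blast)+
  define F where "F T = \<Phi> (app T)" for T
  have F_dual: "F T \<in> dual_space" if "T \<in> ops" for T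
    using bij that by (auto simp: F_def bij_betw_def)
  have F_norm: "onorm (F T) = norm T" if "T \<in> ops" for T
    using iso[OF that that] by (simp add: F_def norm_endo_eq_onorm)
  have F_add: "F (S + T) p = F S p + F T p" if "S \<in> ops" "T \<in> ops" for S T p
  proof -
    have "app (S + T) = (\<lambda>x. app S x + app T x)" by auto
    then show ?thesis using add[OF that] by (simp add: F_def)
  qed
  have F_bound: "norm (F T p) \<le> norm T * norm p" if "T \<in> ops" for T p
    using onorm[of "F T" p] F_dual[OF that] F_norm[OF that] by (auto simp: dual_space_def)
  define X where "X = (\<Pi>\<^sub>E p\<in>(UNIV :: 'p set). cball (0::complex) (K * norm p))"
  have "compactin (product_topology (\<lambda>p::'p. euclidean) UNIV) X"
    unfolding X_def compactin_PiE by simp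
  then have "compact X" by (simp add: euclidean_product_topology)
  define H where "H = filtermap (\<lambda>n. F (c n)) sequentially"
  have "F (c n) \<in> X" for n
    using order_trans[OF F_bound[OF c(1)] mult_right_mono[OF c(2)]] by (simp add: X_def PiE_iff)
  then have "eventually (\<lambda>g. g \<in> X) H" by (simp add: H_def eventually_filtermap)
  moreover have "H \<noteq> bot" by (simp add: H_def filtermap_bot_iff)
  ultimately obtain f where f: "f \<in> X" and G: "inf (nhds f) H \<noteq> bot"
    using \<open>compact X\<close> unfolding compact_filter by blast
  \<comment> \<open>Along \<open>G\<close> the functionals converge pointwise to \<open>f\<close>, and \<open>G\<close> sees only tails of the sequence.\<close>
  define G where "G = inf (nhds f) H"
  have G_bot: "G \<noteq> bot" using G by (simp add: G_def)
  have lim: "((\<lambda>g. g p) \<longlongrightarrow> f p) G" for p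
  proof -
    have "((\<lambda>g. g p) \<longlongrightarrow> f p) (nhds f)"
    proof (rule topological_tendstoI)
      fix U :: "complex set" assume "open U" "f p \<in> U"
      moreover have "open ((\<lambda>g::'p \<Rightarrow> complex. g p) -` U)"
        using \<open>open U\<close> by (intro open_vimage continuous_on_product_coordinates)
      ultimately show "eventually (\<lambda>g. g p \<in> U) (nhds f)"
        unfolding eventually_nhds by (intro exI[of _ "(\<lambda>g. g p) -` U"]) simp
    qed
    then show ?thesis unfolding G_def by (rule tendsto_mono[rotated]) simp
  qed
  have ev: "eventually P G" if "\<And>n. n \<ge> m \<Longrightarrow> P (F (c n))" for P m
  proof -
    have "eventually P H"
      unfolding H_def eventually_filtermap using that by (rule eventually_sequentiallyI)
    then show ?thesis unfolding G_def by (rule filter_leD[rotated]) simp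
  qed
  have f_add: "f (p + q) = f p + f q" for p q
  proof (rule tendsto_unique[OF G_bot lim])
    have "eventually (\<lambda>g. g p + g q = g (p + q)) G"
      using F_dual[OF c(1)] by (intro ev[of 0]) (auto simp: dual_space_def linear_simps)
    with tendsto_add[OF lim lim] show "((\<lambda>g. g (p + q)) \<longlongrightarrow> f p + f q) G"
      by (rule Lim_transform_eventually)
  qed
  have f_scaleC: "f (a *\<^sub>C p) = a * f p" for a p
  proof (rule tendsto_unique[OF G_bot lim])
    have "eventually (\<lambda>g. a * g p = g (a *\<^sub>C p)) G"
      using F_dual[OF c(1)] by (intro ev[of 0]) (auto simp: dual_space_def)
    with tendsto_mult_left[OF lim] show "((\<lambda>g. g (a *\<^sub>C p)) \<longlongrightarrow> a * f p) G"
      by (rule Lim_transform_eventually)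
  qed
  have "f \<in> dual_space"
  proof -
    have "bounded_linear f"
    proof (rule bounded_linear_intro[where K=K])
      show "f (r *\<^sub>R p) = r *\<^sub>R f p" for r p
        using f_scaleC[of "complex_of_real r" p] by (simp add: scaleC_of_real scaleR_conv_of_real)
      show "norm (f p) \<le> norm p * K" for p
        using f by (auto simp: X_def mult.commute)
    qed (rule f_add)
    then show ?thesis by (simp add: dual_space_def f_scaleC)
  qed
  then obtain c' where c': "c' \<in> ops" "F c' = f"
    using bij unfolding bij_betw_def F_def by (metis (mono_tags) image_iff)
  show ?thesis
  proof (intro bexI[of _ c'] ballI allI impI)
    fix z L m assume z: "z \<in> ops" and L: "\<forall>n\<ge>m. norm (c n + z) \<le> L"
    have L0: "0 \<le> L" using L norm_ge_zero order_trans by blast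
    have "norm (F (c' + z) p) \<le> L * norm p" for p
    proof (rule tendsto_upperbound[OF _ _ G_bot])
      show "((\<lambda>g. norm (g p + F z p)) \<longlongrightarrow> norm (F (c' + z) p)) G"
        unfolding F_add[OF c'(1) z] c'(2) by (intro tendsto_intros lim)
      have "norm (F (c n) p + F z p) \<le> L * norm p" if "n \<ge> m" for n
      proof -
        have "norm (F (c n + z) p) \<le> norm (c n + z) * norm p"
          using c(1) z by (intro F_bound) simp
        also have "\<dots> \<le> L * norm p" using L that by (intro mult_right_mono) auto
        finally show ?thesis by (simp add: F_add[OF c(1) z])
      qed
      then show "eventually (\<lambda>g. norm (g p + F z p) \<le> L * norm p) G" by (rule ev)
    qed
    then have "onorm (F (c' + z)) \<le> L" using L0 by (intro onorm_bound)
    then show "norm (c' + z) \<le> L" using F_norm[of "c' + z"] c'(1) z by simp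
  qed (rule c'(1))
qed

section \<open>Range inclusion and majorization\<close>

theorem range_inclusion_iff_majorization:
  assumes W: "is_W_star_algebra TYPE('p::complex_banach) (adjointable_ops ip)"
    and A: "A \<in> ops" and B: "B \<in> ops"
    and dense: "closure (range (app (adjoint A))) = UNIV"
  shows "(\<exists>l>0. \<exists>S\<in>ops. l *\<^sub>R (A * adjoint A) - B * adjoint B = adjoint S * S)
    \<longleftrightarrow> range (app B) \<subseteq> range (app A)"
proof
  assume "\<exists>l>0. \<exists>S\<in>ops. l *\<^sub>R (A * adjoint A) - B * adjoint B = adjoint S * S"
  then obtain l S where l: "0 < l" and S: "S \<in> ops"
    and eq: "l *\<^sub>R (A * adjoint A) - B * adjoint B = adjoint S * S" by blast
  \<comment> \<open>The factorization requires an element of norm at most 1.\<close>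
  define s where "s = norm A + 1"
  have s: "0 < s" "norm A \<le> s" by (simp_all add: s_def add_nonneg_pos)
  define a where "a = (1 / s) *\<^sub>R adjoint A"
  have "\<exists>c\<in>ops. c * a = adjoint B"
  proof (rule factorization_of_majorized)
    show "a \<in> ops" "adjoint B \<in> ops" using A B by (simp_all add: a_def)
    show "norm a \<le> 1" using A s by (simp add: a_def)
    show "0 \<le> l * s\<^sup>2" using l by simp
    have "(l * s\<^sup>2) *\<^sub>R (adjoint a * a) - adjoint (adjoint B) * adjoint B = adjoint S * S"
      using A B s by (simp add: a_def eq[symmetric] power2_eq_square)
    then show "nonneg ((l * s\<^sup>2) *\<^sub>R (adjoint a * a) - adjoint (adjoint B) * adjoint B)"
      using nonneg_st_mult[OF S] by simp
    show "\<exists>c'\<in>ops. \<forall>z\<in>ops. \<forall>L. \<forall>m. (\<forall>n\<ge>m. norm (c n + z) \<le> L) \<longrightarrow> norm (c' + z) \<le> L"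
      if "\<And>n. c n \<in> ops" "\<And>n. norm (c n) \<le> K" for c :: "nat \<Rightarrow> 'v endo" and K
      by (rule ball_cluster_point[OF W that])
  qed
  then obtain c where c: "c \<in> ops" "c * a = adjoint B" by blast
  have "adjoint (adjoint B) = adjoint a * adjoint c"
    unfolding c(2)[symmetric] using c(1) A by (simp add: a_def)
  then have "B = A * ((1 / s) *\<^sub>R adjoint c)" using A B by (simp add: a_def)
  then have "app B x = app A (app ((1 / s) *\<^sub>R adjoint c) x)" for x by (metis app_simps(6))
  then show "range (app B) \<subseteq> range (app A)" by auto
next
  assume "range (app B) \<subseteq> range (app A)"
  then obtain C where C: "C \<in> ops" "B = A * C"
    by (rule factor_of_range_subset[OF A B dense]) (rule that)
  \<comment> \<open>The summand 1 makes \<open>\<parallel>T\<parallel> < 1\<close>, so that \<open>1 - T\<close> has a square root.\<close>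
  define l where "l = (norm C)\<^sup>2 + 1"
  have l: "0 < l" by (simp add: l_def add_nonneg_pos)
  define T where "T = (1 / l) *\<^sub>R (C * adjoint C)"
  have T: "T \<in> ops" "adjoint T = T" using C by (simp_all add: T_def)
  have "norm T < 1" using l norm_mult_st[OF C(1)] by (simp add: T_def l_def)
  with T obtain S where S: "S \<in> ops" "adjoint S = S" "(1 - S) * (1 - S) = 1 - T"
    using sqrt_one_minus by blast
  define R where "R = sqrt l *\<^sub>R ((1 - S) * adjoint A)"
  have "adjoint R * R = l *\<^sub>R (A * (1 - S) * ((1 - S) * adjoint A))"
    using A S(1,2) l by (simp add: R_def)
  also have "\<dots> = l *\<^sub>R (A * ((1 - S) * (1 - S)) * adjoint A)"
    by (simp only: mult.assoc)
  also have "\<dots> = l *\<^sub>R (A * adjoint A) - B * adjoint B"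
    unfolding S(3) using A C l by (simp add: T_def algebra_simps)
  finally have "l *\<^sub>R (A * adjoint A) - B * adjoint B = adjoint R * R" ..
  moreover have "R \<in> ops" using A S by (simp add: R_def)
  ultimately show "\<exists>l>0. \<exists>S\<in>ops. l *\<^sub>R (A * adjoint A) - B * adjoint B = adjoint S * S"
    using l by blast
qed

end

theorem theorem2p12:
  fixes ip :: "'e::complex_banach \<Rightarrow> 'e \<Rightarrow> 'a::cstar_algebra"
    and act :: "'e \<Rightarrow> 'a \<Rightarrow> 'e"
    and A B :: "'e \<Rightarrow> 'e"
  assumes "hilbert_cstar_module ip act"
    and "is_W_star_algebra TYPE('p::complex_banach) (adjointable_ops ip)"
    and "A \<in> adjointable_ops ip" and "B \<in> adjointable_ops ip"
    and "closure (range (module_adjoint ip A)) = UNIV"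
  shows "(\<exists>l::real. l > 0 \<and>
            op_le ip (B \<circ> module_adjoint ip B) (\<lambda>x. l *\<^sub>R (A \<circ> module_adjoint ip A) x))
         \<longleftrightarrow> range B \<subseteq> range A"
proof -
  interpret cauchy_schwarz_module ip
    using assms(1) by (rule hilbert_cstar_module_cauchy_schwarz)
  obtain P Q where P: "P \<in> ops" "A = app P" and Q: "Q \<in> ops" "B = app Q"
    using assms(3,4) unfolding adjointable_ops_eq by blast
  have "op_le ip (B \<circ> module_adjoint ip B) (\<lambda>x. l *\<^sub>R (A \<circ> module_adjoint ip A) x)
      \<longleftrightarrow> (\<exists>S\<in>ops. l *\<^sub>R (P * adjoint P) - Q * adjoint Q = adjoint S * S)" for l :: real
  proof -
    have "(\<lambda>x. l *\<^sub>R (A \<circ> module_adjoint ip A) x - (B \<circ> module_adjoint ip B) x)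
        = app (l *\<^sub>R (P * adjoint P) - Q * adjoint Q)"
      using P Q by (auto simp: module_adjoint_app)
    then show ?thesis unfolding op_le_def by (simp only: op_positive_app)
  qed
  moreover have "closure (range (app (adjoint P))) = UNIV"
    using assms(5) P by (simp add: module_adjoint_app)
  ultimately show ?thesis
    using range_inclusion_iff_majorization[OF assms(2) P(1) Q(1)] P Q by simp
qed

end
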